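(* If for every $\varepsilon>0$ the problem Max-$3$-Lin-2 Above Average can be solved in $O(2^{\varepsilon k}2^{\varepsilon m})$ time (where $k$ is the parameter and $m$ the number of equations), then for every $\delta>0$, 3SAT can be solved in $O(2^{\delta n})$ time, where $n$ is the number of variables.
   Context: Max-$3$-Lin-2 Above Average: the input is a parameter $k\ge 0$ and a system of $m$ linear equations over $\mathbb{F}_2$, each with at most $3$ variables and a positive integer weight; with $W$ the total weight, the question is whether some assignment satisfies equations of total weight at least $W/2+k/2$. 3SAT is satisfiability of CNF formulas with at most three literals per clause. *)

theory Defs
  imports Complex_Main "HOL-Library.Z2"
begin

section \<open>Machine model\<close>

text \<open>
  Running times are measured on a uniform-cost machine with finitely many variables, each holding
  an S-expression whose leaves are natural numbers (as in Jones's language WHILE, with numbers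
  added). Every elementary instruction and every evaluation of a test takes one step. As on the
  uniform-cost RAM, arithmetic is restricted to addition and truncated subtraction; with unit-cost
  multiplication the model would no longer be polynomially related to Turing machines.
  Tests inspect only the root of a tree; comparing two trees is not an elementary operation.
\<close>

datatype sexp = Num nat | Node sexp sexp

type_synonym state = "nat \<Rightarrow> sexp"

fun num :: "sexp \<Rightarrow> nat" where
  "num (Num n) = n"
| "num (Node _ _) = 0"

fun left :: "sexp \<Rightarrow> sexp" where
  "left (Node a _) = a"
| "left (Num _) = Num 0"

fun right :: "sexp \<Rightarrow> sexp" where
  "right (Node _ b) = b"
| "right (Num _) = Num 0"

fun is_node :: "sexp \<Rightarrow> bool" where
  "is_node (Node _ _) = True"
| "is_node (Num _) = False"

text \<open>In each assignment the first argument is the target variable.\<close>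

datatype com =
    CConst nat nat
  | CCopy nat nat
  | CAdd nat nat nat
  | CSub nat nat nat
  | CNode nat nat nat
  | CLeft nat nat
  | CRight nat nat
  | CIsNode nat nat
  | CSeq com com
  | CIf nat com com
  | CWhile nat com

text \<open>\<open>exec c s t s'\<close>: started in \<open>s\<close>, the program \<open>c\<close> halts in \<open>s'\<close> after exactly \<open>t\<close> steps.\<close>

inductive exec :: "com \<Rightarrow> state \<Rightarrow> nat \<Rightarrow> state \<Rightarrow> bool" where
  Const: "exec (CConst x n) s 1 (s(x := Num n))"
| Copy: "exec (CCopy x y) s 1 (s(x := s y))"
| Add: "exec (CAdd x y z) s 1 (s(x := Num (num (s y) + num (s z))))"
| Sub: "exec (CSub x y z) s 1 (s(x := Num (num (s y) - num (s z))))"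
| Node: "exec (CNode x y z) s 1 (s(x := Node (s y) (s z)))"
| Left: "exec (CLeft x y) s 1 (s(x := left (s y)))"
| Right: "exec (CRight x y) s 1 (s(x := right (s y)))"
| IsNode: "exec (CIsNode x y) s 1 (s(x := Num (of_bool (is_node (s y)))))"
| Seq: "exec c1 s t1 s1 \<Longrightarrow> exec c2 s1 t2 s2 \<Longrightarrow> exec (CSeq c1 c2) s (t1 + t2) s2"
| IfTrue: "s x \<noteq> Num 0 \<Longrightarrow> exec c1 s t s' \<Longrightarrow> exec (CIf x c1 c2) s (1 + t) s'"
| IfFalse: "s x = Num 0 \<Longrightarrow> exec c2 s t s' \<Longrightarrow> exec (CIf x c1 c2) s (1 + t) s'"
| WhileFalse: "s x = Num 0 \<Longrightarrow> exec (CWhile x c) s 1 s"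
| WhileTrue: "s x \<noteq> Num 0 \<Longrightarrow> exec c s t1 s1 \<Longrightarrow> exec (CWhile x c) s1 t2 s2
    \<Longrightarrow> exec (CWhile x c) s (1 + t1 + t2) s2"

inductive_cases exec_CSeqE: "exec (CSeq c1 c2) s t s'"
inductive_cases exec_CIfE: "exec (CIf x c1 c2) s t s'"
inductive_cases exec_CWhileE: "exec (CWhile x c) s t s'"

lemma exec_deterministic:
  "exec c s t s' \<Longrightarrow> exec c s u s'' \<Longrightarrow> t = u \<and> s' = s''"
proof (induction arbitrary: u s'' rule: exec.induct)
  case Const
  then show ?case by (cases rule: exec.cases) simp_all
next
  case Copy
  then show ?case by (cases rule: exec.cases) simp_all
next
  case Add
  then show ?case by (cases rule: exec.cases) simp_all
next
  case Sub
  then show ?case by (cases rule: exec.cases) simp_all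
next
  case Node
  then show ?case by (cases rule: exec.cases) simp_all
next
  case Left
  then show ?case by (cases rule: exec.cases) simp_all
next
  case Right
  then show ?case by (cases rule: exec.cases) simp_all
next
  case IsNode
  then show ?case by (cases rule: exec.cases) simp_all
next
  case (Seq c1 s t1 s1 c2 t2 s2)
  from Seq.prems show ?case
    by (rule exec_CSeqE) (metis Seq.IH)
next
  case (IfTrue s x c1 t s' c2)
  from IfTrue.prems IfTrue.hyps(1) obtain u' where "u = 1 + u'" "exec c1 s u' s''"
    by (auto elim: exec_CIfE)
  with IfTrue.IH show ?case by blast
next
  case (IfFalse s x c2 t s' c1)
  from IfFalse.prems IfFalse.hyps(1) obtain u' where "u = 1 + u'" "exec c2 s u' s''"
    by (auto elim: exec_CIfE)
  with IfFalse.IH show ?case by blast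
next
  case (WhileFalse s x c)
  from WhileFalse.prems WhileFalse.hyps show ?case
    by (auto elim: exec_CWhileE)
next
  case (WhileTrue s x c t1 s1 t2 s2)
  from WhileTrue.prems WhileTrue.hyps(1) obtain u1 u2 r
    where *: "u = 1 + u1 + u2" "exec c s u1 r" "exec (CWhile x c) r u2 s''"
    by (auto elim: exec_CWhileE)
  with WhileTrue.IH(1) have "t1 = u1" "s1 = r" by blast+
  with * WhileTrue.IH(2) show ?case by blast
qed

text \<open>The input is placed in variable 0, all other variables being \<open>Num 0\<close>; the answer is "yes"
  iff variable 0 differs from \<open>Num 0\<close> at the end.\<close>

definition initial :: "sexp \<Rightarrow> state" where
  "initial d = (\<lambda>_. Num 0)(0 := d)"

record 'a problem =
  instances :: "'a set"
  encode :: "'a \<Rightarrow> sexp"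
  is_yes :: "'a \<Rightarrow> bool"

definition decides_within :: "com \<Rightarrow> 'a problem \<Rightarrow> ('a \<Rightarrow> real) \<Rightarrow> bool" where
  "decides_within P Q T \<longleftrightarrow>
     (\<forall>I\<in>instances Q. \<exists>t s. exec P (initial (encode Q I)) t s
        \<and> (s 0 \<noteq> Num 0 \<longleftrightarrow> is_yes Q I) \<and> real t \<le> T I)"

definition solvable_in_time_O :: "'a problem \<Rightarrow> ('a \<Rightarrow> real) \<Rightarrow> bool" where
  "solvable_in_time_O Q f \<longleftrightarrow> (\<exists>P C. decides_within P Q (\<lambda>I. C * f I))"

fun enc_list :: "('a \<Rightarrow> sexp) \<Rightarrow> 'a list \<Rightarrow> sexp" where
  "enc_list e [] = Num 0"
| "enc_list e (x # xs) = Node (e x) (enc_list e xs)"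


section \<open>Max-3-Lin-2 Above Average\<close>

text \<open>The equation \<open>(vs, b, w)\<close> states that the variables in \<open>vs\<close> sum to \<open>b\<close>; its weight is \<open>w\<close>.\<close>

type_synonym equation = "nat list \<times> bit \<times> nat"

fun wf_equation :: "equation \<Rightarrow> bool" where
  "wf_equation (vs, b, w) \<longleftrightarrow> distinct vs \<and> length vs \<le> 3 \<and> w > 0"

fun weight :: "equation \<Rightarrow> nat" where
  "weight (vs, b, w) = w"

fun satisfies_equation :: "(nat \<Rightarrow> bit) \<Rightarrow> equation \<Rightarrow> bool" where
  "satisfies_equation \<alpha> (vs, b, w) \<longleftrightarrow> (\<Sum>v\<leftarrow>vs. \<alpha> v) = b"

definition total_weight :: "equation list \<Rightarrow> nat" where
  "total_weight E = (\<Sum>e\<leftarrow>E. weight e)"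

definition satisfied_weight :: "(nat \<Rightarrow> bit) \<Rightarrow> equation list \<Rightarrow> nat" where
  "satisfied_weight \<alpha> E = (\<Sum>e\<leftarrow>filter (satisfies_equation \<alpha>) E. weight e)"

fun enc_equation :: "equation \<Rightarrow> sexp" where
  "enc_equation (vs, b, w) =
     Node (enc_list Num vs) (Node (Num (of_bool (b = 1))) (Num w))"

text \<open>An instance is a pair of the parameter \<open>k\<close> and the system of equations.\<close>

definition max3lin2_aa :: "(nat \<times> equation list) problem" where
  "max3lin2_aa =
    \<lparr>instances = {(k, E). \<forall>e\<in>set E. wf_equation e},
     encode = (\<lambda>(k, E). Node (Num k) (enc_list enc_equation E)),
     is_yes = (\<lambda>(k, E). \<exists>\<alpha>. real (satisfied_weight \<alpha> E) \<ge> real (total_weight E) / 2 + real k / 2)\<rparr>"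


section \<open>3SAT\<close>

datatype literal = Pos (var: nat) | Neg (var: nat)

type_synonym clause = "literal list"

fun satisfies_literal :: "(nat \<Rightarrow> bool) \<Rightarrow> literal \<Rightarrow> bool" where
  "satisfies_literal \<alpha> (Pos v) \<longleftrightarrow> \<alpha> v"
| "satisfies_literal \<alpha> (Neg v) \<longleftrightarrow> \<not> \<alpha> v"

text \<open>
  A formula is a set of clauses and a clause a set of literals, both listed without repetition.
  If clauses could be repeated, the length of the input would not be bounded in terms of the number
  of variables, and no algorithm could run in time depending on that number alone.
\<close>

definition wf_3cnf :: "clause list \<Rightarrow> bool" where
  "wf_3cnf F \<longleftrightarrow> (\<forall>c\<in>set F. distinct c \<and> length c \<le> 3) \<and> distinct (map set F)"

definition satisfiable :: "clause list \<Rightarrow> bool" where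
  "satisfiable F \<longleftrightarrow> (\<exists>\<alpha>. \<forall>c\<in>set F. \<exists>l\<in>set c. satisfies_literal \<alpha> l)"

definition num_vars :: "clause list \<Rightarrow> nat" where
  "num_vars F = card (\<Union>c\<in>set F. var ` set c)"

fun enc_literal :: "literal \<Rightarrow> sexp" where
  "enc_literal (Pos v) = Node (Num 1) (Num v)"
| "enc_literal (Neg v) = Node (Num 0) (Num v)"

definition three_sat :: "clause list problem" where
  "three_sat =
    \<lparr>instances = {F. wf_3cnf F},
     encode = enc_list (enc_list enc_literal),
     is_yes = satisfiable\<rparr>"

end

theory Submission
  imports Defs
begin

text \<open>
  The formula is sparsified as by Impagliazzo, Paturi and Zane. While some literal lies in at least
  \<open>q\<close> clauses of length 2, some pair of literals in at least \<open>q\<close> clauses of length 3, or some literal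
  in at least \<open>q\<^sup>2\<close> clauses of length 3, the search branches on this heart \<open>h\<close>: a satisfying
  assignment satisfies \<open>h\<close> or, in each of these clauses, the petal that remains when \<open>h\<close> is removed.
  Adding \<open>h\<close> or the petals subsumes the longer clauses. A potential between 0 and \<open>12 q n\<close>, which
  counts unit clauses and added clauses of length 2, drops by at least 1 in the first branch and by
  at least \<open>q\<^sup>2\<close> in the second, so for large \<open>q\<close> the tree has at most \<open>2 \<cdot> 2 powr (\<gamma> n)\<close> nodes. Its
  leaves have \<open>O(n)\<close> clauses, each of which becomes at most 10 equations of total excess 2 if the
  clause is satisfied and at most 0 otherwise, so that the assumed algorithm decides a leaf in time
  \<open>O(2 powr (\<gamma> n))\<close>.
\<close>

section \<open>Programs with a time bound\<close>

text \<open>The assumed algorithm is exponential in the number of equations, whereas a 3CNF formula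
  may have cubically many clauses. What makes sparsifying affordable is the imbalance of the
  branches: drops of 1 and \<open>q\<^sup>2\<close> give a tree whose growth rate per unit of
  potential is of order \<open>log q / q\<^sup>2\<close>, which beats the range
  \<open>12 q n\<close>; a second drop of order \<open>q\<close> would not. This dictates the
  thresholds. A petal that is a unit clause is worth order \<open>q\<close>, so \<open>q\<close> of
  them suffice; a petal of length 2 is worth 1, so \<open>q\<^sup>2\<close> are needed. A new unit
  must also pay for the added pairs that it subsumes, hence no literal may lie in more than order
  \<open>q\<close> added pairs; for this reason pairs of literals have a threshold of their own and
  the three kinds of heart are tested in a fixed order.

  On the machine, all work at a node apart from the call of the assumed algorithm is one
  polynomial-time function, obtained from closure properties instead of an explicit program.
  Explicit code is confined to the loop over a stack of open formulas.\<close>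

fun var_bound :: "com \<Rightarrow> nat" where
  "var_bound (CConst x n) = Suc x"
| "var_bound (CCopy x y) = Suc (max x y)"
| "var_bound (CAdd x y z) = Suc (max x (max y z))"
| "var_bound (CSub x y z) = Suc (max x (max y z))"
| "var_bound (CNode x y z) = Suc (max x (max y z))"
| "var_bound (CLeft x y) = Suc (max x y)"
| "var_bound (CRight x y) = Suc (max x y)"
| "var_bound (CIsNode x y) = Suc (max x y)"
| "var_bound (CSeq c d) = max (var_bound c) (var_bound d)"
| "var_bound (CIf x c d) = max (Suc x) (max (var_bound c) (var_bound d))"
| "var_bound (CWhile x c) = max (Suc x) (var_bound c)"

lemma exec_frame: "exec c s t s' \<Longrightarrow> var_bound c \<le> x \<Longrightarrow> s' x = s x"
  by (induction rule: exec.induct) auto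

text \<open>The assumed algorithm is specified only for a start in which all variables except 0 are
  \<open>Num 0\<close>. As a subroutine it starts while variables outside its range hold the stack
  and the answer; this lemma transfers its run to such a state.\<close>

lemma exec_agree:
  assumes "exec c s t s'" and "var_bound c \<le> N" and "\<forall>x<N. r x = s x"
  shows "\<exists>r'. exec c r t r' \<and> (\<forall>x<N. r' x = s' x)"
  using assms
proof (induction arbitrary: r rule: exec.induct)
  case (Const x n s)
  from Const show ?case by - (rule exI, rule conjI, rule exec.Const, simp)
next
  case (Copy x y s)
  from Copy show ?case by - (rule exI, rule conjI, rule exec.Copy, simp)
next
  case (Add x y z s)
  from Add show ?case by - (rule exI, rule conjI, rule exec.Add, simp)
next
  case (Sub x y z s)
  from Sub show ?case by - (rule exI, rule conjI, rule exec.Sub, simp)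
next
  case (Node x y z s)
  from Node show ?case by - (rule exI, rule conjI, rule exec.Node, simp)
next
  case (Left x y s)
  from Left show ?case by - (rule exI, rule conjI, rule exec.Left, simp)
next
  case (Right x y s)
  from Right show ?case by - (rule exI, rule conjI, rule exec.Right, simp)
next
  case (IsNode x y s)
  from IsNode show ?case by - (rule exI, rule conjI, rule exec.IsNode, simp)
next
  case (Seq c1 s t1 s1 c2 t2 s2)
  from Seq.prems(1) have bound: "var_bound c1 \<le> N" "var_bound c2 \<le> N" by simp_all
  obtain r1 where r1: "exec c1 r t1 r1" "\<forall>x<N. r1 x = s1 x"
    using Seq.IH(1)[OF bound(1) Seq.prems(2)] by blast
  obtain r2 where "exec c2 r1 t2 r2" "\<forall>x<N. r2 x = s2 x"
    using Seq.IH(2)[OF bound(2) r1(2)] by blast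
  with exec.Seq[OF r1(1)] show ?case by blast
next
  case (IfTrue s x c1 t s' c2)
  from IfTrue.prems have bound: "x < N" "var_bound c1 \<le> N" by simp_all
  obtain r' where r': "exec c1 r t r'" "\<forall>x<N. r' x = s' x"
    using IfTrue.IH[OF bound(2) IfTrue.prems(2)] by blast
  have "r x \<noteq> Num 0" using IfTrue.hyps(1) IfTrue.prems(2) bound(1) by metis
  from exec.IfTrue[OF this r'(1)] r'(2) show ?case by blast
next
  case (IfFalse s x c2 t s' c1)
  from IfFalse.prems have bound: "x < N" "var_bound c2 \<le> N" by simp_all
  obtain r' where r': "exec c2 r t r'" "\<forall>x<N. r' x = s' x"
    using IfFalse.IH[OF bound(2) IfFalse.prems(2)] by blast
  have "r x = Num 0" using IfFalse.hyps(1) IfFalse.prems(2) bound(1) by metis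
  from exec.IfFalse[OF this r'(1)] r'(2) show ?case by blast
next
  case (WhileFalse s x c)
  then have "r x = Num 0" by simp
  from exec.WhileFalse[of r x c, OF this] WhileFalse.prems(2) show ?case by blast
next
  case (WhileTrue s x c t1 s1 t2 s2)
  from WhileTrue.prems have bound: "x < N" "var_bound c \<le> N" by simp_all
  obtain r1 where r1: "exec c r t1 r1" "\<forall>x<N. r1 x = s1 x"
    using WhileTrue.IH(1)[OF bound(2) WhileTrue.prems(2)] by blast
  obtain r2 where r2: "exec (CWhile x c) r1 t2 r2" "\<forall>x<N. r2 x = s2 x"
    using WhileTrue.IH(2)[OF WhileTrue.prems(1) r1(2)] by blast
  have "r x \<noteq> Num 0" using WhileTrue.hyps(1) WhileTrue.prems(2) bound(1) by metis
  from exec.WhileTrue[OF this r1(1) r2(1)] r2(2) show ?case by blast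
qed

section \<open>Total correctness with time bounds\<close>

definition runs :: "com \<Rightarrow> state \<Rightarrow> nat \<Rightarrow> (state \<Rightarrow> bool) \<Rightarrow> bool" where
  "runs c s T Q \<longleftrightarrow> (\<exists>t s'. exec c s t s' \<and> t \<le> T \<and> Q s')"

lemma runs_weaken:
  "runs c s T Q \<Longrightarrow> T \<le> T' \<Longrightarrow> (\<And>s'. Q s' \<Longrightarrow> Q' s') \<Longrightarrow> runs c s T' Q'"
  unfolding runs_def by (meson order_trans)

lemma runs_frame:
  "runs c s T Q \<Longrightarrow> runs c s T (\<lambda>s'. Q s' \<and> (\<forall>x\<ge>var_bound c. s' x = s x))"
  unfolding runs_def using exec_frame by blast

lemma runs_basic:
  "runs (CConst x n) s (Suc 0) Q \<longleftrightarrow> Q (s(x := Num n))"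
  "runs (CCopy x y) s (Suc 0) Q \<longleftrightarrow> Q (s(x := s y))"
  "runs (CAdd x y z) s (Suc 0) Q \<longleftrightarrow> Q (s(x := Num (num (s y) + num (s z))))"
  "runs (CSub x y z) s (Suc 0) Q \<longleftrightarrow> Q (s(x := Num (num (s y) - num (s z))))"
  "runs (CNode x y z) s (Suc 0) Q \<longleftrightarrow> Q (s(x := Node (s y) (s z)))"
  "runs (CLeft x y) s (Suc 0) Q \<longleftrightarrow> Q (s(x := left (s y)))"
  "runs (CRight x y) s (Suc 0) Q \<longleftrightarrow> Q (s(x := right (s y)))"
  "runs (CIsNode x y) s (Suc 0) Q \<longleftrightarrow> Q (s(x := Num (of_bool (is_node (s y)))))"
  unfolding runs_def
  by (force intro: exec.intros[unfolded One_nat_def] elim: exec.cases)+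

lemma runs_Seq:
  "runs c s T (\<lambda>r. runs d r T' Q) \<Longrightarrow> runs (CSeq c d) s (T + T') Q"
  unfolding runs_def by (meson add_mono exec.Seq)

lemma runs_Seq_basic:
  "runs d (s(x := Num n)) T Q \<Longrightarrow> runs (CSeq (CConst x n) d) s (Suc T) Q"
  "runs d (s(x := s y)) T Q \<Longrightarrow> runs (CSeq (CCopy x y) d) s (Suc T) Q"
  "runs d (s(x := Node (s y) (s z))) T Q \<Longrightarrow> runs (CSeq (CNode x y z) d) s (Suc T) Q"
  "runs d (s(x := left (s y))) T Q \<Longrightarrow> runs (CSeq (CLeft x y) d) s (Suc T) Q"
  "runs d (s(x := right (s y))) T Q \<Longrightarrow> runs (CSeq (CRight x y) d) s (Suc T) Q"
  using runs_Seq[where T = "Suc 0"] by (simp_all add: runs_basic)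

text \<open>Programs obtained from an existence statement are known only through their
  \<open>var_bound\<close>. The frame condition lets values stored at or above that bound survive a
  call.\<close>

lemma runs_Seq_frame:
  assumes "runs c s T Q"
    and "\<And>r. Q r \<Longrightarrow> (\<And>x. var_bound c \<le> x \<Longrightarrow> r x = s x) \<Longrightarrow> runs d r T' R"
  shows "runs (CSeq c d) s (T + T') R"
  using assms by (intro runs_Seq runs_weaken[OF runs_frame[OF assms(1)]]) auto

lemma runs_If:
  assumes "s x \<noteq> Num 0 \<Longrightarrow> runs c s T Q" and "s x = Num 0 \<Longrightarrow> runs d s T Q"
  shows "runs (CIf x c d) s (Suc T) Q"
proof (cases "s x = Num 0")
  case True
  then obtain t s' where "exec d s t s'" "t \<le> T" "Q s'" using assms(2) by (auto simp: runs_def)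
  then show ?thesis
    unfolding runs_def using exec.IfFalse[of s x d t s' c] True by (intro exI[of _ "1 + t"]) auto
next
  case False
  then obtain t s' where "exec c s t s'" "t \<le> T" "Q s'" using assms(1) by (auto simp: runs_def)
  then show ?thesis
    unfolding runs_def using exec.IfTrue[of s x c t s' d] False by (intro exI[of _ "1 + t"]) auto
qed

lemma runs_While_False: "s x = Num 0 \<Longrightarrow> Q s \<Longrightarrow> runs (CWhile x c) s 1 Q"
  unfolding runs_def by (blast intro: exec.WhileFalse)

lemma runs_While_True:
  assumes "s x \<noteq> Num 0" and "runs c s T (\<lambda>r. runs (CWhile x c) r T' Q)"
  shows "runs (CWhile x c) s (Suc (T + T')) Q"
proof -
  obtain t1 r t2 s' where *: "exec c s t1 r" "t1 \<le> T" "exec (CWhile x c) r t2 s'" "t2 \<le> T'" "Q s'"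
    using assms(2) by (auto simp: runs_def)
  have "exec (CWhile x c) s (1 + t1 + t2) s'"
    using assms(1) *(1,3) by (rule exec.WhileTrue)
  with * show ?thesis unfolding runs_def by (intro exI[of _ "1 + t1 + t2"]) auto
qed

section \<open>Polynomial bounds in the size of the input\<close>

fun leaves :: "sexp \<Rightarrow> nat" where
  "leaves (Num _) = 1"
| "leaves (Node a b) = leaves a + leaves b"

lemma leaves_pos: "0 < leaves a"
  by (induction a) auto

text \<open>Polynomial bounds are expressed as powers of \<open>leaves + 1\<close>, which is at least 2.\<close>

definition poly_bounded :: "'i set \<Rightarrow> ('i \<Rightarrow> sexp) \<Rightarrow> ('i \<Rightarrow> nat) \<Rightarrow> bool" where
  "poly_bounded D e g \<longleftrightarrow> (\<exists>k. \<forall>i\<in>D. g i \<le> Suc (leaves (e i)) ^ k)"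

lemma poly_bounded_mono:
  "poly_bounded D e g \<Longrightarrow> (\<And>i. i \<in> D \<Longrightarrow> f i \<le> g i) \<Longrightarrow> poly_bounded D e f"
  unfolding poly_bounded_def by (meson order_trans)

lemma poly_bounded_const: "poly_bounded D e (\<lambda>_. n)"
  unfolding poly_bounded_def
proof (intro exI ballI)
  fix i
  have "n \<le> 2 ^ n" by (simp add: less_imp_le)
  also have "\<dots> \<le> Suc (leaves (e i)) ^ n"
    using leaves_pos[of "e i"] by (intro power_mono) auto
  finally show "n \<le> Suc (leaves (e i)) ^ n" .
qed

lemma poly_bounded_leaves: "poly_bounded D e (\<lambda>i. leaves (e i))"
  unfolding poly_bounded_def by (intro exI[of _ 1]) simp

lemma poly_bounded_mult:
  assumes "poly_bounded D e f" "poly_bounded D e g"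
  shows "poly_bounded D e (\<lambda>i. f i * g i)"
proof -
  obtain k l where "\<forall>i\<in>D. f i \<le> Suc (leaves (e i)) ^ k" "\<forall>i\<in>D. g i \<le> Suc (leaves (e i)) ^ l"
    using assms by (auto simp: poly_bounded_def)
  then show ?thesis
    unfolding poly_bounded_def
    by (intro exI[of _ "k + l"]) (auto simp: power_add intro!: mult_mono)
qed

lemma poly_bounded_add:
  assumes "poly_bounded D e f" "poly_bounded D e g"
  shows "poly_bounded D e (\<lambda>i. f i + g i)"
proof -
  \<comment> \<open>Sums reduce to products by \<open>f + g <= (f + 1) * (g + 1)\<close>, and
    successors by \<open>h + 1 <= 2 * max 1 h\<close>.\<close>
  have "poly_bounded D e (\<lambda>i. Suc (f i) * Suc (g i))"
  proof (rule poly_bounded_mult)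
    have Suc: "poly_bounded D e (\<lambda>i. Suc (h i))" if "poly_bounded D e h" for h
    proof -
      have "poly_bounded D e (\<lambda>i. max 1 (h i))"
        using that unfolding poly_bounded_def by (metis max.bounded_iff one_le_power le_add1 plus_1_eq_Suc)
      from poly_bounded_mult[OF poly_bounded_const[of D e 2] this] show ?thesis
        by (rule poly_bounded_mono) auto
    qed
    show "poly_bounded D e (\<lambda>i. Suc (f i))" "poly_bounded D e (\<lambda>i. Suc (g i))"
      using assms by (auto intro: Suc)
  qed
  then show ?thesis by (rule poly_bounded_mono) simp
qed

lemma poly_bounded_Suc: "poly_bounded D e f \<Longrightarrow> poly_bounded D e (\<lambda>i. Suc (f i))"
  using poly_bounded_add[OF poly_bounded_const[of D e 1]] by simp

lemma poly_bounded_power: "poly_bounded D e f \<Longrightarrow> poly_bounded D e (\<lambda>i. f i ^ k)"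
  by (induction k) (auto intro: poly_bounded_mult poly_bounded_const)

lemma poly_bounded_trans:
  assumes "poly_bounded D e (\<lambda>i. leaves (f i))" "poly_bounded D f g"
  shows "poly_bounded D e g"
proof -
  obtain k where "\<forall>i\<in>D. g i \<le> Suc (leaves (f i)) ^ k"
    using assms(2) by (auto simp: poly_bounded_def)
  then show ?thesis
    by (intro poly_bounded_mono[OF poly_bounded_power[OF poly_bounded_Suc[OF assms(1)], of k]]) auto
qed

lemma poly_bounded_reindex:
  assumes "poly_bounded D' e' g" "\<And>i. i \<in> D \<Longrightarrow> h i \<in> D'"
  shows "poly_bounded D (\<lambda>i. e' (h i)) (\<lambda>i. g (h i))"
  using assms unfolding poly_bounded_def by blast

lemmas poly_bounded_intros = poly_bounded_const poly_bounded_leaves poly_bounded_mult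
  poly_bounded_add poly_bounded_Suc poly_bounded_power

text \<open>The bound on the size of \<open>f i\<close> is not implied by the one on the time: a tree with shared
  subtrees can be exponentially larger than the time needed to build it.\<close>

definition ptime :: "'i set \<Rightarrow> ('i \<Rightarrow> sexp) \<Rightarrow> ('i \<Rightarrow> sexp) \<Rightarrow> bool" where
  "ptime D e f \<longleftrightarrow>
     (\<exists>c T. poly_bounded D e T \<and> (\<forall>i\<in>D. \<forall>s. s 0 = e i \<longrightarrow> runs c s (T i) (\<lambda>s'. s' 0 = f i)))
     \<and> poly_bounded D e (\<lambda>i. leaves (f i))"

section \<open>Closure properties of polynomial time\<close>

lemma ptimeI:
  assumes "\<And>i s. i \<in> D \<Longrightarrow> s 0 = e i \<Longrightarrow> runs c s (T i) (\<lambda>s'. s' 0 = f i)"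
    and "poly_bounded D e T" and "poly_bounded D e (\<lambda>i. leaves (f i))"
  shows "ptime D e f"
  using assms unfolding ptime_def by blast

lemma ptime_leaves: "ptime D e f \<Longrightarrow> poly_bounded D e (\<lambda>i. leaves (f i))"
  unfolding ptime_def by blast

lemma ptime_cong:
  assumes "ptime D e f" "\<And>i. i \<in> D \<Longrightarrow> f i = g i" shows "ptime D e g"
proof -
  obtain c T where *: "\<And>i s. i \<in> D \<Longrightarrow> s 0 = e i \<Longrightarrow> runs c s (T i) (\<lambda>s'. s' 0 = f i)"
    "poly_bounded D e T" "poly_bounded D e (\<lambda>i. leaves (f i))"
    using assms(1) unfolding ptime_def by blast
  show ?thesis
    by (rule ptimeI[of D e c T]) (use * assms(2) in \<open>auto simp: poly_bounded_def\<close>)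
qed

lemma ptime_reindex:
  assumes "ptime D' e' f" "\<And>i. i \<in> D \<Longrightarrow> h i \<in> D'"
  shows "ptime D (\<lambda>i. e' (h i)) (\<lambda>i. f (h i))"
proof -
  obtain c T where *: "\<And>i s. i \<in> D' \<Longrightarrow> s 0 = e' i \<Longrightarrow> runs c s (T i) (\<lambda>s'. s' 0 = f i)"
    "poly_bounded D' e' T" "poly_bounded D' e' (\<lambda>i. leaves (f i))"
    using assms(1) unfolding ptime_def by blast
  show ?thesis
    by (rule ptimeI[of D _ c "\<lambda>i. T (h i)"])
      (use *(1) assms(2) poly_bounded_reindex[OF *(2) assms(2)]
        poly_bounded_reindex[OF *(3) assms(2)] in auto)
qed

lemma ptime_subset: "ptime D e f \<Longrightarrow> D' \<subseteq> D \<Longrightarrow> ptime D' e f"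
  using ptime_reindex[of D e f D' "\<lambda>i. i"] by blast

text \<open>The second program can follow the first because \<open>ptime\<close> assumes nothing
  about variables other than 0. Its time is polynomial in the size of the intermediate value, so
  here the size bound in \<open>ptime\<close> is indispensable.\<close>

lemma ptime_comp:
  assumes "ptime D e f" "ptime D f g" shows "ptime D e g"
proof -
  obtain c T where c: "\<And>i s. i \<in> D \<Longrightarrow> s 0 = e i \<Longrightarrow> runs c s (T i) (\<lambda>s'. s' 0 = f i)"
    "poly_bounded D e T" "poly_bounded D e (\<lambda>i. leaves (f i))"
    using assms(1) unfolding ptime_def by blast
  obtain d U where d: "\<And>i s. i \<in> D \<Longrightarrow> s 0 = f i \<Longrightarrow> runs d s (U i) (\<lambda>s'. s' 0 = g i)"
    "poly_bounded D f U" "poly_bounded D f (\<lambda>i. leaves (g i))"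
    using assms(2) unfolding ptime_def by blast
  show ?thesis
  proof (rule ptimeI[of D e "CSeq c d" "\<lambda>i. T i + U i"])
    fix i and s :: state assume "i \<in> D" "s 0 = e i"
    then show "runs (CSeq c d) s (T i + U i) (\<lambda>s'. s' 0 = g i)"
      using d(1) by (intro runs_Seq runs_weaken[OF c(1)]) auto
  qed (auto intro: poly_bounded_add c poly_bounded_trans[OF c(3)] d)
qed

lemma ptime_id: "ptime D e e"
  by (rule ptimeI[of D e "CCopy 0 0" "\<lambda>_. Suc 0"])
    (auto simp: runs_basic intro: poly_bounded_intros)

lemma ptime_Num: "ptime D e (\<lambda>_. Num n)"
  by (rule ptimeI[of D e "CConst 0 n" "\<lambda>_. Suc 0"])
    (auto simp: runs_basic intro: poly_bounded_intros)

lemma leaves_left: "leaves (left a) \<le> leaves a"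
  by (cases a) auto

lemma leaves_right: "leaves (right a) \<le> leaves a"
  by (cases a) auto

lemma ptime_left: assumes "ptime D e f" shows "ptime D e (\<lambda>i. left (f i))"
  by (rule ptime_comp[OF assms], rule ptimeI[of D _ "CLeft 0 0" "\<lambda>_. Suc 0"])
    (auto simp: runs_basic leaves_left intro: poly_bounded_intros poly_bounded_mono[OF poly_bounded_leaves])

lemma ptime_right: assumes "ptime D e f" shows "ptime D e (\<lambda>i. right (f i))"
  by (rule ptime_comp[OF assms], rule ptimeI[of D _ "CRight 0 0" "\<lambda>_. Suc 0"])
    (auto simp: runs_basic leaves_right intro: poly_bounded_intros poly_bounded_mono[OF poly_bounded_leaves])

lemma ptime_is_node: assumes "ptime D e f" shows "ptime D e (\<lambda>i. Num (of_bool (is_node (f i))))"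
  by (rule ptime_comp[OF assms], rule ptimeI[of D _ "CIsNode 0 0" "\<lambda>_. Suc 0"])
    (auto simp: runs_basic intro: poly_bounded_intros)

lemma ptime_Node:
  assumes "ptime D e f" "ptime D e g" shows "ptime D e (\<lambda>i. Node (f i) (g i))"
proof -
  obtain c T where c: "\<And>i s. i \<in> D \<Longrightarrow> s 0 = e i \<Longrightarrow> runs c s (T i) (\<lambda>s'. s' 0 = f i)"
    "poly_bounded D e T" "poly_bounded D e (\<lambda>i. leaves (f i))"
    using assms(1) unfolding ptime_def by blast
  obtain d U where d: "\<And>i s. i \<in> D \<Longrightarrow> s 0 = e i \<Longrightarrow> runs d s (U i) (\<lambda>s'. s' 0 = g i)"
    "poly_bounded D e U" "poly_bounded D e (\<lambda>i. leaves (g i))"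
    using assms(2) unfolding ptime_def by blast
  \<comment> \<open>Lies above both variable bounds and differs from 0. Variable \<open>N\<close>
    keeps the input for the second program, \<open>Suc N\<close> the result of the first.\<close>
  define N where "N = Suc (max (var_bound c) (var_bound d))"
  let ?p = "CSeq (CCopy N 0) (CSeq c (CSeq (CCopy (Suc N) 0) (CSeq (CCopy 0 N) (CSeq d (CNode 0 (Suc N) 0)))))"
  show ?thesis
  proof (rule ptimeI[of D e ?p "\<lambda>i. Suc (T i + Suc (Suc (U i + Suc 0)))"])
    fix i and s :: state assume i: "i \<in> D" "s 0 = e i"
    show "runs ?p s (Suc (T i + Suc (Suc (U i + Suc 0)))) (\<lambda>s'. s' 0 = Node (f i) (g i))"
      apply (rule runs_Seq_basic, rule runs_Seq_frame, rule c(1)[OF i(1)])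
       apply (simp add: i N_def)
      apply (rule runs_Seq_basic, rule runs_Seq_basic, rule runs_Seq_frame, rule d(1)[OF i(1)])
       apply (simp add: i N_def)
      apply (subst runs_basic)
      apply (simp add: N_def)
      done
  qed (auto intro!: poly_bounded_intros c d)
qed

text \<open>Each branch has to be computable only where it is taken. This permits partial operations
  such as \<open>hd\<close> behind a test for nonemptiness.\<close>

lemma ptime_if:
  assumes "ptime D e (\<lambda>i. Num (of_bool (b i)))"
    and "ptime {i \<in> D. b i} e f" and "ptime {i \<in> D. \<not> b i} e g"
  shows "ptime D e (\<lambda>i. if b i then f i else g i)"
proof -
  obtain a S where a: "\<And>i s. i \<in> D \<Longrightarrow> s 0 = e i \<Longrightarrow> runs a s (S i) (\<lambda>s'. s' 0 = Num (of_bool (b i)))"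
    "poly_bounded D e S"
    using assms(1) unfolding ptime_def by blast
  obtain c T where c: "\<And>i s. i \<in> {i \<in> D. b i} \<Longrightarrow> s 0 = e i \<Longrightarrow> runs c s (T i) (\<lambda>s'. s' 0 = f i)"
    "poly_bounded {i \<in> D. b i} e T" "poly_bounded {i \<in> D. b i} e (\<lambda>i. leaves (f i))"
    using assms(2) unfolding ptime_def by blast
  obtain d U where d: "\<And>i s. i \<in> {i \<in> D. \<not> b i} \<Longrightarrow> s 0 = e i \<Longrightarrow> runs d s (U i) (\<lambda>s'. s' 0 = g i)"
    "poly_bounded {i \<in> D. \<not> b i} e U" "poly_bounded {i \<in> D. \<not> b i} e (\<lambda>i. leaves (g i))"
    using assms(3) unfolding ptime_def by blast
  have poly_if: "poly_bounded D e (\<lambda>i. if b i then f' i else g' i)"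
    if f': "poly_bounded {i \<in> D. b i} e f'" and g': "poly_bounded {i \<in> D. \<not> b i} e g'" for f' g'
  proof -
    obtain k l where kl: "\<forall>i\<in>D. b i \<longrightarrow> f' i \<le> Suc (leaves (e i)) ^ k"
      "\<forall>i\<in>D. \<not> b i \<longrightarrow> g' i \<le> Suc (leaves (e i)) ^ l"
      using f' g' by (auto simp: poly_bounded_def)
    have poly_pow: "poly_bounded D e (\<lambda>i. Suc (leaves (e i)) ^ j)" for j
      by (intro poly_bounded_intros)
    have "(if b i then f' i else g' i) \<le> Suc (leaves (e i)) ^ k + Suc (leaves (e i)) ^ l" if "i \<in> D" for i
      using kl that by (simp add: trans_le_add1 trans_le_add2)
    then show ?thesis
      by (rule poly_bounded_mono[OF poly_bounded_add[OF poly_pow poly_pow]])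
  qed
  define N where "N = Suc (var_bound a)"
  let ?p = "CSeq (CCopy N 0) (CSeq a (CSeq (CCopy (Suc N) 0) (CSeq (CCopy 0 N) (CIf (Suc N) c d))))"
  show ?thesis
  proof (rule ptimeI[of D e ?p "\<lambda>i. Suc (S i + Suc (Suc (Suc (if b i then T i else U i))))"])
    fix i and s :: state assume i: "i \<in> D" "s 0 = e i"
    show "runs ?p s (Suc (S i + Suc (Suc (Suc (if b i then T i else U i))))) (\<lambda>s'. s' 0 = (if b i then f i else g i))"
      apply (rule runs_Seq_basic, rule runs_Seq_frame, rule a(1)[OF i(1)])
       apply (simp add: i N_def)
      apply (rule runs_Seq_basic, rule runs_Seq_basic, rule runs_If)
       apply (auto simp: i N_def intro!: c(1) d(1) split: if_splits)
      done
  next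
    have "(\<lambda>i. leaves (if b i then f i else g i)) = (\<lambda>i. if b i then leaves (f i) else leaves (g i))"
      by auto
    then show "poly_bounded D e (\<lambda>i. leaves (if b i then f i else g i))"
      using poly_if[OF c(3) d(3)] by simp
  qed (intro poly_bounded_intros a poly_if c d)
qed

lemma leaves_enc_list_append:
  "leaves (enc_list e (xs @ ys)) + 1 = leaves (enc_list e xs) + leaves (enc_list e ys)"
  by (induction xs) auto

lemma leaves_enc_list_mem: "x \<in> set xs \<Longrightarrow> leaves (e x) < leaves (enc_list e xs)"
  by (induction xs) (auto simp: leaves_pos trans_less_add2)

lemma length_less_leaves_enc_list: "length xs < leaves (enc_list e xs)"
proof (induction xs)
  case (Cons x xs)
  then show ?case using leaves_pos[of "e x"] by simp
qed simp

text \<open>The only loop among the closure properties; all list functions below reduce to it. A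
  polynomial-time step can square the size of the accumulator in every round, so the bound
  \<open>B\<close> on all intermediate accumulators has to be supplied separately.\<close>

lemma ptime_foldl:
  assumes "ptime D e (\<lambda>i. enc_list ex (L i))" and "ptime D e (\<lambda>i. ea (A i))"
    and "ptime {p. fst p \<in> D} (\<lambda>p. Node (e (fst p)) (Node (ea (fst (snd p))) (ex (snd (snd p)))))
           (\<lambda>p. ea (f (fst p) (fst (snd p)) (snd (snd p))))"
    and "poly_bounded D e B"
    and size: "\<And>i xs ys. i \<in> D \<Longrightarrow> L i = xs @ ys \<Longrightarrow> leaves (ea (foldl (f i) (A i) xs)) \<le> B i"
  shows "ptime D e (\<lambda>i. ea (foldl (f i) (A i) (L i)))"
proof -
  obtain c T where c: "\<And>i s. i \<in> D \<Longrightarrow> s 0 = e i \<Longrightarrow> runs c s (T i) (\<lambda>s'. s' 0 = enc_list ex (L i))"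
    "poly_bounded D e T" "poly_bounded D e (\<lambda>i. leaves (enc_list ex (L i)))"
    using assms(1) unfolding ptime_def by blast
  obtain d U where d: "\<And>i s. i \<in> D \<Longrightarrow> s 0 = e i \<Longrightarrow> runs d s (U i) (\<lambda>s'. s' 0 = ea (A i))"
    "poly_bounded D e U"
    using assms(2) unfolding ptime_def by blast
  let ?env = "\<lambda>p. Node (e (fst p)) (Node (ea (fst (snd p))) (ex (snd (snd p))))"
  let ?f = "\<lambda>p. ea (f (fst p) (fst (snd p)) (snd (snd p)))"
  obtain b V where b: "\<And>p s. p \<in> {p. fst p \<in> D} \<Longrightarrow> s 0 = ?env p \<Longrightarrow> runs b s (V p) (\<lambda>s'. s' 0 = ?f p)"
    "poly_bounded {p. fst p \<in> D} ?env V"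
    using assms(3) unfolding ptime_def by blast
  obtain k where "\<forall>p\<in>{p. fst p \<in> D}. V p \<le> Suc (leaves (?env p)) ^ k"
    using b(2) by (auto simp only: poly_bounded_def)
  then have k: "\<And>p. fst p \<in> D \<Longrightarrow> V p \<le> Suc (leaves (?env p)) ^ k"
    by blast
  \<comment> \<open>A time bound for one round that is uniform in the round: the accumulator has
    size at most \<open>B i\<close>, and an element is smaller than the encoded list containing
    it.\<close>
  define W where "W i = Suc (leaves (e i) + (B i + leaves (enc_list ex (L i)))) ^ k" for i
  have W: "poly_bounded D e W"
    unfolding W_def by (intro poly_bounded_intros assms(4) c)
  \<comment> \<open>Variable \<open>N\<close> holds the input, \<open>N+1\<close> the rest of the
    list and \<open>N+2\<close> the accumulator.\<close>
  define N where "N = Suc (max (var_bound c) (max (var_bound d) (var_bound b)))"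
  have N: "0 < N" "var_bound c \<le> N" "var_bound d \<le> N" "var_bound b \<le> N"
    by (simp_all add: N_def)
  let ?body = "CSeq (CLeft 0 (N+1)) (CSeq (CRight (N+1) (N+1)) (CSeq (CNode 0 (N+2) 0)
    (CSeq (CNode 0 N 0) (CSeq b (CCopy (N+2) 0)))))"
  \<comment> \<open>The 6 counts the loop test and the five elementary instructions around
    \<open>b\<close>; the final 1 is the failing test.\<close>
  have loop: "runs (CWhile (N+1) ?body) s (length ys * (W i + 6) + 1) (\<lambda>s'. s' (N+2) = ea (foldl (f i) (A i) (L i)))"
    if "i \<in> D" "L i = xs @ ys" "s N = e i" "s (N+1) = enc_list ex ys" "s (N+2) = ea (foldl (f i) (A i) xs)"
    for i xs ys s
    using that
  proof (induction ys arbitrary: xs s)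
    case Nil
    then show ?case using runs_While_False by simp
  next
    case (Cons y ys)
    let ?p = "(i, foldl (f i) (A i) xs, y)"
    have "V ?p \<le> Suc (leaves (?env ?p)) ^ k" using k[of ?p] Cons.prems(1) by simp
    also have "\<dots> \<le> W i"
    proof -
      have "leaves (ex y) < leaves (enc_list ex (L i))"
        using Cons.prems(2) by (intro leaves_enc_list_mem) simp
      then show ?thesis
        unfolding W_def using size[OF Cons.prems(1,2)] by (intro power_mono) auto
    qed
    finally have V: "V ?p \<le> W i" .
    have "runs ?body s (Suc (Suc (Suc (Suc (V ?p + Suc 0)))))
        (\<lambda>r. runs (CWhile (N+1) ?body) r (length ys * (W i + 6) + 1)
          (\<lambda>s'. s' (N+2) = ea (foldl (f i) (A i) (L i))))"
      apply (rule runs_Seq_basic)+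
      apply (rule runs_Seq_frame, rule b(1)[of ?p])
        apply (simp add: Cons.prems)
       apply (use Cons.prems N in simp)
      apply (subst runs_basic)
      apply (rule Cons.IH[of "xs @ [y]"])
          apply (use Cons.prems N in simp_all)
      done
    then have "runs (CWhile (N+1) ?body) s (Suc (Suc (Suc (Suc (Suc (V ?p + Suc 0)))) + (length ys * (W i + 6) + 1)))
       (\<lambda>s'. s' (N+2) = ea (foldl (f i) (A i) (L i)))"
      using Cons.prems by (intro runs_While_True) auto
    then show ?case
      by (rule runs_weaken) (use V in auto)
  qed
  let ?p = "CSeq (CCopy N 0) (CSeq c (CSeq (CCopy (N+1) 0) (CSeq (CCopy 0 N) (CSeq d
    (CSeq (CCopy (N+2) 0) (CSeq (CWhile (N+1) ?body) (CCopy 0 (N+2))))))))"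
  let ?T = "\<lambda>i. Suc (T i + (Suc (Suc (U i + (Suc ((length (L i) * (W i + 6) + 1) + Suc 0))))))"
  show ?thesis
  proof (rule ptimeI[of D e ?p ?T])
    fix i and s :: state assume i: "i \<in> D" "s 0 = e i"
    show "runs ?p s (?T i) (\<lambda>s'. s' 0 = ea (foldl (f i) (A i) (L i)))"
      apply (rule runs_Seq_basic, rule runs_Seq_frame, rule c(1)[OF i(1)])
       apply (use i N in simp)
      apply (rule runs_Seq_basic, rule runs_Seq_basic, rule runs_Seq_frame, rule d(1)[OF i(1)])
       apply (use i N in simp)
      apply (rule runs_Seq_basic, rule runs_Seq)
      apply (subst runs_basic)
      apply simp
      apply (rule loop[of i "[]" "L i", simplified])
         apply (use i N in simp_all)
      done
  next
    have "poly_bounded D e (\<lambda>i. length (L i))"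
      using c(3) by (rule poly_bounded_mono) (simp add: length_less_leaves_enc_list less_imp_le)
    then show "poly_bounded D e ?T"
      by (intro poly_bounded_intros c d W)
    show "poly_bounded D e (\<lambda>i. leaves (ea (foldl (f i) (A i) (L i))))"
      by (rule poly_bounded_mono[OF assms(4)]) (auto intro: size)
  qed
qed

section \<open>Polynomial-time list functions\<close>

lemma ptime_env_fst: "ptime D (\<lambda>p. Node (e p) (h p)) e"
  using ptime_left[OF ptime_id[of D "\<lambda>p. Node (e p) (h p)"]] by simp

lemma ptime_env_snd: "ptime D (\<lambda>p. Node (e p) (h p)) h"
  using ptime_right[OF ptime_id[of D "\<lambda>p. Node (e p) (h p)"]] by simp

lemma ptime_env_acc: "ptime D (\<lambda>p. Node (e p) (Node (f p) (g p))) f"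
  by (rule ptime_comp[OF ptime_env_snd ptime_env_fst])

lemma ptime_env_elem: "ptime D (\<lambda>p. Node (e p) (Node (f p) (g p))) g"
  by (rule ptime_comp[OF ptime_env_snd ptime_env_snd])

text \<open>Weakening of the environment: inside a map, filter or fold the input is paired with the
  current element, and functions of the input alone remain computable there.\<close>

lemma ptime_env:
  "ptime D e g \<Longrightarrow> ptime {p. fst p \<in> D} (\<lambda>p. Node (e (fst p)) (h p)) (\<lambda>p. g (fst p))"
  by (rule ptime_comp[OF ptime_env_fst ptime_reindex]) auto

lemma ptime_Cons:
  "ptime D e (\<lambda>i. ex (x i)) \<Longrightarrow> ptime D e (\<lambda>i. enc_list ex (xs i)) \<Longrightarrow>
    ptime D e (\<lambda>i. enc_list ex (x i # xs i))"
  by (simp add: ptime_Node)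

lemma ptime_Nil: "ptime D e (\<lambda>i. enc_list ex [])"
  by (simp add: ptime_Num)

lemma ptime_hd:
  assumes "ptime D e (\<lambda>i. enc_list ex (L i))" "\<And>i. i \<in> D \<Longrightarrow> L i \<noteq> []"
  shows "ptime D e (\<lambda>i. ex (hd (L i)))"
  using ptime_left[OF assms(1)]
proof (rule ptime_cong)
  fix i assume "i \<in> D"
  then show "left (enc_list ex (L i)) = ex (hd (L i))"
    using assms(2)[of i] by (cases "L i") auto
qed

lemma ptime_nonempty:
  assumes "ptime D e (\<lambda>i. enc_list ex (L i))"
  shows "ptime D e (\<lambda>i. Num (of_bool (L i \<noteq> [])))"
  using ptime_is_node[OF assms]
proof (rule ptime_cong)
  fix i show "Num (of_bool (is_node (enc_list ex (L i)))) = Num (of_bool (L i \<noteq> []))"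
    by (cases "L i") auto
qed

lemma leaves_enc_list_rev: "leaves (enc_list e (rev xs)) = leaves (enc_list e xs)"
proof (induction xs)
  case (Cons x xs)
  then show ?case using leaves_enc_list_append[of e "rev xs" "[x]"] by simp
qed simp

lemma foldl_Cons_eq: "foldl (\<lambda>a x. x # a) ys xs = rev xs @ ys"
  by (induction xs arbitrary: ys) auto

text \<open>A left fold with the list constructor pushes in front and so reverses. Applied to
  \<open>M = []\<close> this gives \<open>rev\<close>, and applied to a reversed list it gives
  append.\<close>

lemma ptime_rev_append:
  assumes "ptime D e (\<lambda>i. enc_list ex (L i))" "ptime D e (\<lambda>i. enc_list ex (M i))"
  shows "ptime D e (\<lambda>i. enc_list ex (rev (L i) @ M i))"
proof -
  let ?B = "\<lambda>i. leaves (enc_list ex (L i)) + leaves (enc_list ex (M i))"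
  let ?D = "{p. fst p \<in> D}"
  let ?e = "\<lambda>p. Node (e (fst p)) (Node (enc_list ex (fst (snd p))) (ex (snd (snd p))))"
  have "ptime D e (\<lambda>i. enc_list ex (foldl (\<lambda>a x. x # a) (M i) (L i)))"
  proof (rule ptime_foldl[where ea = "enc_list ex" and B = ?B, OF assms])
    show "ptime ?D ?e (\<lambda>p. enc_list ex (snd (snd p) # fst (snd p)))"
      by (rule ptime_Cons[OF ptime_env_elem ptime_env_acc])
    show "poly_bounded D e ?B"
      using assms by (intro poly_bounded_add ptime_leaves)
    fix i xs ys assume "i \<in> D" "L i = xs @ ys"
    then show "leaves (enc_list ex (foldl (\<lambda>a x. x # a) (M i) xs)) \<le> ?B i"
      using leaves_enc_list_append[of ex "rev xs" "M i"] leaves_enc_list_append[of ex xs ys]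
        leaves_pos[of "enc_list ex ys"]
      by (simp add: foldl_Cons_eq leaves_enc_list_rev)
  qed
  then show ?thesis by (simp add: foldl_Cons_eq)
qed

lemma ptime_rev:
  "ptime D e (\<lambda>i. enc_list ex (L i)) \<Longrightarrow> ptime D e (\<lambda>i. enc_list ex (rev (L i)))"
  using ptime_rev_append[OF _ ptime_Nil] by fastforce

lemma ptime_append:
  "ptime D e (\<lambda>i. enc_list ex (L i)) \<Longrightarrow> ptime D e (\<lambda>i. enc_list ex (M i)) \<Longrightarrow>
    ptime D e (\<lambda>i. enc_list ex (L i @ M i))"
  using ptime_rev_append[OF ptime_rev] by fastforce

lemma foldl_append_eq: "foldl (\<lambda>a x. f x @ a) ys xs = concat (map f (rev xs)) @ ys"
  by (induction xs arbitrary: ys) auto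

text \<open>The fold runs over the reversed list because each round puts its result in front. An
  accumulator consists of at most \<open>length (L i)\<close> pieces of polynomially bounded
  size.\<close>

lemma ptime_concat_map:
  assumes L: "ptime D e (\<lambda>i. enc_list ex (L i))"
    and f: "ptime {p. fst p \<in> D} (\<lambda>p. Node (e (fst p)) (ex (snd p)))
      (\<lambda>p. enc_list ey (f (fst p) (snd p)))"
  shows "ptime D e (\<lambda>i. enc_list ey (concat (map (f i) (L i))))"
proof -
  obtain k where "\<forall>p\<in>{p. fst p \<in> D}. leaves (enc_list ey (f (fst p) (snd p)))
      \<le> Suc (leaves (Node (e (fst p)) (ex (snd p)))) ^ k"
    using ptime_leaves[OF f] by (auto simp only: poly_bounded_def)
  then have k: "leaves (enc_list ey (f i x)) \<le> Suc (leaves (e i) + leaves (ex x)) ^ k"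
    if "i \<in> D" for i x
    using that by auto
  \<comment> \<open>Bounds the size of \<open>f i x\<close> for all elements \<open>x\<close> of
    \<open>L i\<close> simultaneously.\<close>
  define W where "W i = Suc (leaves (e i) + leaves (enc_list ex (L i))) ^ k" for i
  let ?B = "\<lambda>i. Suc (leaves (enc_list ex (L i)) * W i)"
  have W: "leaves (enc_list ey (concat (map (f i) xs))) \<le> Suc (length xs * W i)"
    if "i \<in> D" "set xs \<subseteq> set (L i)" for i xs
    using that
  proof (induction xs)
    case (Cons x xs)
    then have "leaves (ex x) < leaves (enc_list ex (L i))"
      by (simp add: leaves_enc_list_mem)
    then have "Suc (leaves (e i) + leaves (ex x)) ^ k \<le> W i"
      unfolding W_def by (intro power_mono) auto
    then show ?case
      using k[OF Cons.prems(1), of x] Cons leaves_enc_list_append[of ey "f i x" "concat (map (f i) xs)"]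
      by simp
  qed simp
  let ?D = "{p. fst p \<in> D}"
  let ?e = "\<lambda>p. Node (e (fst p)) (Node (enc_list ey (fst (snd p))) (ex (snd (snd p))))"
  have "ptime D e (\<lambda>i. enc_list ey (foldl (\<lambda>a x. f i x @ a) [] (rev (L i))))"
  proof (rule ptime_foldl[where ea = "enc_list ey" and B = ?B, OF ptime_rev[OF L] ptime_Nil])
    have "ptime ?D ?e (\<lambda>p. enc_list ey (f (fst p) (snd (snd p))))"
      using ptime_comp[OF ptime_Node[OF ptime_env_fst ptime_env_elem]
        ptime_reindex[OF f, where h = "\<lambda>p. (fst p, snd (snd p))" and D = ?D]] by simp
    then show "ptime ?D ?e (\<lambda>p. enc_list ey (f (fst p) (snd (snd p)) @ fst (snd p)))"
      by (rule ptime_append[OF _ ptime_env_acc])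
    show "poly_bounded D e ?B"
      unfolding W_def using L by (intro poly_bounded_intros ptime_leaves)
    fix i xs ys assume *: "i \<in> D" "rev (L i) = xs @ ys"
    then have L_eq: "L i = rev ys @ rev xs" by (metis rev_append rev_rev_ident)
    have "leaves (enc_list ey (concat (map (f i) (rev xs)))) \<le> Suc (length (rev xs) * W i)"
      using * L_eq by (intro W) auto
    also have "length (rev xs) \<le> leaves (enc_list ex (L i))"
      using length_less_leaves_enc_list[of "L i" ex] L_eq by simp
    finally show "leaves (enc_list ey (foldl (\<lambda>a x. f i x @ a) [] xs)) \<le> ?B i"
      by (simp add: foldl_append_eq)
  qed
  then show ?thesis by (simp add: foldl_append_eq)
qed

lemma ptime_map:
  assumes "ptime D e (\<lambda>i. enc_list ex (L i))"
    and "ptime {p. fst p \<in> D} (\<lambda>p. Node (e (fst p)) (ex (snd p))) (\<lambda>p. ey (f (fst p) (snd p)))"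
  shows "ptime D e (\<lambda>i. enc_list ey (map (f i) (L i)))"
proof -
  have "ptime D e (\<lambda>i. enc_list ey (concat (map (\<lambda>x. [f i x]) (L i))))"
    by (intro ptime_concat_map[OF assms(1)] ptime_Cons ptime_Nil assms(2))
  then show ?thesis by (simp add: concat_map_singleton)
qed

lemma ptime_filter:
  assumes "ptime D e (\<lambda>i. enc_list ex (L i))"
    and "ptime {p. fst p \<in> D} (\<lambda>p. Node (e (fst p)) (ex (snd p)))
      (\<lambda>p. Num (of_bool (P (fst p) (snd p))))"
  shows "ptime D e (\<lambda>i. enc_list ex (filter (P i) (L i)))"
proof -
  have "ptime D e (\<lambda>i. enc_list ex (concat (map (\<lambda>x. if P i x then [x] else []) (L i))))"
  proof (rule ptime_concat_map[OF assms(1)])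
    let ?e = "\<lambda>p. Node (e (fst p)) (ex (snd p))"
    have "ptime {p. fst p \<in> D} ?e
      (\<lambda>p. if P (fst p) (snd p) then enc_list ex [snd p] else enc_list ex [])"
      by (intro ptime_if assms(2) ptime_Cons ptime_Nil ptime_env_snd)
    then show "ptime {p. fst p \<in> D} ?e
      (\<lambda>p. enc_list ex (if P (fst p) (snd p) then [snd p] else []))"
      by (rule ptime_cong) simp
  qed
  moreover have "concat (map (\<lambda>x. if Q x then [x] else []) xs) = filter Q xs" for Q and xs :: "'b list"
    by (induction xs) auto
  ultimately show ?thesis by simp
qed

section \<open>Boolean and arithmetic tests\<close>

lemma ptime_not:
  assumes "ptime D e (\<lambda>i. Num (of_bool (P i)))"
  shows "ptime D e (\<lambda>i. Num (of_bool (\<not> P i)))"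
  using ptime_if[OF assms ptime_Num[of _ _ 0] ptime_Num[of _ _ 1]]
  by (rule ptime_cong) simp

lemma ptime_conj:
  assumes "ptime D e (\<lambda>i. Num (of_bool (P i)))" "ptime D e (\<lambda>i. Num (of_bool (Q i)))"
  shows "ptime D e (\<lambda>i. Num (of_bool (P i \<and> Q i)))"
  using ptime_if[OF assms(1) ptime_subset[OF assms(2)] ptime_Num[of _ _ 0]]
  by (rule ptime_cong) auto

lemma ptime_Bex:
  assumes "ptime D e (\<lambda>i. enc_list ex (L i))"
    and "ptime {p. fst p \<in> D} (\<lambda>p. Node (e (fst p)) (ex (snd p)))
      (\<lambda>p. Num (of_bool (P (fst p) (snd p))))"
  shows "ptime D e (\<lambda>i. Num (of_bool (\<exists>x\<in>set (L i). P i x)))"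
  using ptime_nonempty[OF ptime_filter[OF assms]]
  by (rule ptime_cong) (auto simp: filter_empty_conv)

lemma ptime_Ball:
  assumes "ptime D e (\<lambda>i. enc_list ex (L i))"
    and "ptime {p. fst p \<in> D} (\<lambda>p. Node (e (fst p)) (ex (snd p)))
      (\<lambda>p. Num (of_bool (P (fst p) (snd p))))"
  shows "ptime D e (\<lambda>i. Num (of_bool (\<forall>x\<in>set (L i). P i x)))"
  using ptime_not[OF ptime_Bex[OF assms(1) ptime_not[OF assms(2)]]]
  by simp

lemma ptime_le:
  assumes "ptime D e (\<lambda>i. Num (m i))" "ptime D e (\<lambda>i. Num (n i))"
  shows "ptime D e (\<lambda>i. Num (of_bool (m i \<le> n i)))"
proof (rule ptime_comp[OF ptime_Node[OF assms]])
  \<comment> \<open>Truncated subtraction yields 0 exactly when \<open>m i <= n i\<close>.\<close>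
  let ?p = "CSeq (CLeft 1 0) (CSeq (CRight 0 0) (CSeq (CSub 1 1 0) (CIf 1 (CConst 0 0) (CConst 0 1))))"
  show "ptime D (\<lambda>i. Node (Num (m i)) (Num (n i))) (\<lambda>i. Num (of_bool (m i \<le> n i)))"
  proof (rule ptimeI[where c = ?p])
    fix i and s :: state assume "i \<in> D" and s: "s 0 = Node (Num (m i)) (Num (n i))"
    show "runs ?p s (Suc (Suc (Suc 0 + Suc (Suc 0)))) (\<lambda>s'. s' 0 = Num (of_bool (m i \<le> n i)))"
      apply (rule runs_Seq_basic, rule runs_Seq_basic, rule runs_Seq)
      apply (subst runs_basic)
      apply (rule runs_If)
       apply (subst runs_basic, use s in simp)+
      done
  qed (intro poly_bounded_intros, simp add: poly_bounded_intros)
qed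

lemma ptime_eq:
  assumes "ptime D e (\<lambda>i. Num (m i))" "ptime D e (\<lambda>i. Num (n i))"
  shows "ptime D e (\<lambda>i. Num (of_bool (m i = n i)))"
  using ptime_conj[OF ptime_le[OF assms] ptime_le[OF assms(2,1)]]
  by (simp add: eq_iff)

lemma ptime_Suc:
  assumes "ptime D e (\<lambda>i. Num (m i))"
  shows "ptime D e (\<lambda>i. Num (Suc (m i)))"
proof (rule ptime_comp[OF assms])
  let ?p = "CSeq (CConst 1 1) (CAdd 0 0 1)"
  show "ptime D (\<lambda>i. Num (m i)) (\<lambda>i. Num (Suc (m i)))"
  proof (rule ptimeI[where c = ?p])
    fix i and s :: state assume "i \<in> D" and s: "s 0 = Num (m i)"
    show "runs ?p s (Suc (Suc 0)) (\<lambda>s'. s' 0 = Num (Suc (m i)))"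
      by (rule runs_Seq_basic, subst runs_basic) (use s in simp)
  qed (intro poly_bounded_intros, simp add: poly_bounded_intros)
qed

lemma ptime_length:
  assumes "ptime D e (\<lambda>i. enc_list ex (L i))"
  shows "ptime D e (\<lambda>i. Num (length (L i)))"
proof -
  let ?D = "{p. fst p \<in> D}"
  let ?e = "\<lambda>p. Node (e (fst p)) (Node (Num (fst (snd p))) (ex (snd (snd p))))"
  have "ptime D e (\<lambda>i. Num (foldl (\<lambda>n x. Suc n) 0 (L i)))"
  \<comment> \<open>A number is a single leaf whatever its value, so the accumulator always has size
    1.\<close>
  proof (rule ptime_foldl[where ea = Num and B = "\<lambda>_. 1", OF assms ptime_Num])
    show "ptime ?D ?e (\<lambda>p. Num (Suc (fst (snd p))))"
      by (rule ptime_Suc[OF ptime_env_acc])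
  qed (simp_all add: poly_bounded_const)
  moreover have "foldl (\<lambda>n x. Suc n) m xs = m + length xs" for m and xs :: "'b list"
    by (induction xs arbitrary: m) auto
  ultimately show ?thesis by simp
qed

section \<open>The branching algorithm in polynomial time per node\<close>

definition positive :: "literal \<Rightarrow> bool" where
  "positive l \<longleftrightarrow> l = Pos (var l)"

lemma positive_simps [simp]: "positive (Pos v)" "\<not> positive (Neg v)"
  by (simp_all add: positive_def)

lemma enc_literal_eq: "enc_literal l = Node (Num (of_bool (positive l))) (Num (var l))"
  by (cases l) auto

abbreviation enc_clause :: "clause \<Rightarrow> sexp" where
  "enc_clause \<equiv> enc_list enc_literal"

abbreviation enc_cnf :: "clause list \<Rightarrow> sexp" where
  "enc_cnf \<equiv> enc_list enc_clause"

lemma ptime_var: "ptime D e (\<lambda>i. enc_literal (l i)) \<Longrightarrow> ptime D e (\<lambda>i. Num (var (l i)))"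
  by (drule ptime_right) (simp add: enc_literal_eq)

lemma ptime_positive:
  "ptime D e (\<lambda>i. enc_literal (l i)) \<Longrightarrow> ptime D e (\<lambda>i. Num (of_bool (positive (l i))))"
  by (drule ptime_left) (simp add: enc_literal_eq)

text \<open>Comparing trees is not elementary, so the comparison goes through two numbers, the
  variable and the sign.\<close>

lemma ptime_literal_eq:
  assumes "ptime D e (\<lambda>i. enc_literal (l i))" "ptime D e (\<lambda>i. enc_literal (l' i))"
  shows "ptime D e (\<lambda>i. Num (of_bool (l i = l' i)))"
proof -
  have "l i = l' i \<longleftrightarrow> var (l i) = var (l' i) \<and>
      (of_bool (positive (l i)) :: nat) = of_bool (positive (l' i))" for i
    by (cases "l i"; cases "l' i") auto
  then show ?thesis
    using assms by (simp only:) (intro ptime_conj ptime_eq ptime_var ptime_positive)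
qed

lemma ptime_literal_mem:
  assumes "ptime D e (\<lambda>i. enc_literal (l i))" "ptime D e (\<lambda>i. enc_clause (c i))"
  shows "ptime D e (\<lambda>i. Num (of_bool (l i \<in> set (c i))))"
proof -
  have "ptime D e (\<lambda>i. Num (of_bool (\<exists>l'\<in>set (c i). l i = l')))"
    by (rule ptime_Bex[OF assms(2) ptime_literal_eq[OF ptime_env[OF assms(1)] ptime_env_snd]])
  then show ?thesis by simp
qed

lemma ptime_clause_subset:
  assumes "ptime D e (\<lambda>i. enc_clause (c i))" "ptime D e (\<lambda>i. enc_clause (d i))"
  shows "ptime D e (\<lambda>i. Num (of_bool (set (c i) \<subseteq> set (d i))))"
proof -
  have "ptime D e (\<lambda>i. Num (of_bool (\<forall>l\<in>set (c i). l \<in> set (d i))))"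
    by (rule ptime_Ball[OF assms(1) ptime_literal_mem[OF ptime_env_snd ptime_env[OF assms(2)]]])
  then show ?thesis by (simp add: subset_iff Ball_def)
qed

text \<open>Removal of subsumed clauses. Strict inclusion prevents a clause from removing itself;
  clauses with equal literal sets do not arise in the search.\<close>

definition reduce :: "clause list \<Rightarrow> clause list" where
  "reduce F = filter (\<lambda>c. \<not> (\<exists>c'\<in>set F. set c' \<subset> set c)) F"

lemma ptime_reduce:
  assumes "ptime D e (\<lambda>i. enc_cnf (F i))"
  shows "ptime D e (\<lambda>i. enc_cnf (reduce (F i)))"
  unfolding reduce_def less_le_not_le[of "set _"]
  by (rule ptime_filter[OF assms], rule ptime_not, rule ptime_Bex[OF ptime_env[OF assms]],
      intro ptime_conj ptime_not ptime_clause_subset ptime_env_snd ptime_env[OF ptime_env_snd])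

text \<open>A weak sunflower: the clauses share the heart \<open>h\<close>, but their petals may
  intersect.\<close>

definition flower :: "clause \<Rightarrow> nat \<Rightarrow> clause list \<Rightarrow> clause list" where
  "flower h j F = filter (\<lambda>c. length c = j \<and> set h \<subseteq> set c) F"

lemma ptime_flower:
  assumes "ptime D e (\<lambda>i. enc_clause (h i))" "ptime D e (\<lambda>i. enc_cnf (F i))"
  shows "ptime D e (\<lambda>i. enc_cnf (flower (h i) j (F i)))"
  unfolding flower_def
  by (rule ptime_filter[OF assms(2) ptime_conj[OF
        ptime_eq[OF ptime_length[OF ptime_env_snd] ptime_Num]
        ptime_clause_subset[OF ptime_env[OF assms(1)] ptime_env_snd]]])

definition petals :: "clause \<Rightarrow> nat \<Rightarrow> clause list \<Rightarrow> clause list" where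
  "petals h j F = map (filter (\<lambda>l. l \<notin> set h)) (flower h j F)"

lemma ptime_petals:
  assumes "ptime D e (\<lambda>i. enc_clause (h i))" "ptime D e (\<lambda>i. enc_cnf (F i))"
  shows "ptime D e (\<lambda>i. enc_cnf (petals (h i) j (F i)))"
  unfolding petals_def
  by (rule ptime_map[OF ptime_flower[OF assms]], rule ptime_filter[OF ptime_env_snd],
      rule ptime_not, rule ptime_literal_mem[OF ptime_env_snd ptime_env[OF ptime_env[OF assms(1)]]])

definition singletons :: "clause list \<Rightarrow> clause list" where
  "singletons F = concat (map (map (\<lambda>l. [l])) F)"

lemma ptime_singletons:
  assumes "ptime D e (\<lambda>i. enc_cnf (F i))"
  shows "ptime D e (\<lambda>i. enc_cnf (singletons (F i)))"
  unfolding singletons_def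
  by (rule ptime_concat_map[OF assms], rule ptime_map[OF ptime_env_snd],
      rule ptime_Cons[OF ptime_env_snd ptime_Nil])

definition pairs :: "clause list \<Rightarrow> clause list" where
  "pairs F = concat (map (\<lambda>c. concat (map (\<lambda>l. map (\<lambda>l'. [l, l']) (filter (\<lambda>l'. l \<noteq> l') c)) c)) F)"

lemma ptime_pairs:
  assumes "ptime D e (\<lambda>i. enc_cnf (F i))"
  shows "ptime D e (\<lambda>i. enc_cnf (pairs (F i)))"
  unfolding pairs_def
  by (rule ptime_concat_map[OF assms] ptime_concat_map[OF ptime_env_snd] ptime_map
    ptime_filter[OF ptime_env[OF ptime_env_snd]] ptime_not ptime_literal_eq ptime_Cons ptime_Nil
    ptime_env_snd ptime_env[OF ptime_env_snd])+

definition heavy :: "nat \<Rightarrow> nat \<Rightarrow> clause list \<Rightarrow> clause list \<Rightarrow> clause list" where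
  "heavy \<theta> j H F = filter (\<lambda>h. \<theta> \<le> length (flower h j F)) H"

lemma ptime_heavy:
  assumes "ptime D e (\<lambda>i. enc_cnf (H i))" "ptime D e (\<lambda>i. enc_cnf (F i))"
  shows "ptime D e (\<lambda>i. enc_cnf (heavy \<theta> j (H i) (F i)))"
  unfolding heavy_def
  by (rule ptime_filter[OF assms(1) ptime_le[OF ptime_Num ptime_length[OF
        ptime_flower[OF ptime_env_snd ptime_env[OF assms(2)]]]]])

text \<open>The order of the tests matters. A pair becomes a heart only when every literal lies in
  fewer than \<open>q\<close> clauses of length 2, and a literal in many 3-clauses only when in
  addition no pair is heavy; both facts limit how many added pairs contain a given literal.\<close>

definition find_heart :: "nat \<Rightarrow> clause list \<Rightarrow> (clause \<times> nat) option" where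
  "find_heart q F =
     (if heavy q 2 (singletons F) F \<noteq> [] then Some (hd (heavy q 2 (singletons F) F), 2)
      else if heavy q 3 (pairs F) F \<noteq> [] then Some (hd (heavy q 3 (pairs F) F), 3)
      else if heavy (q * q) 3 (singletons F) F \<noteq> []
        then Some (hd (heavy (q * q) 3 (singletons F) F), 3)
      else None)"

text \<open>States that the truth values of the literals in \<open>c\<close> sum to 1. A negative
  literal has the value of its variable plus 1, and moving this 1 across flips the right-hand
  side.\<close>

definition equation_of :: "nat \<Rightarrow> clause \<Rightarrow> equation" where
  "equation_of w c = (map var c, foldl (\<lambda>b l. if positive l then b else b + 1) 1 c, w)"

lemma ptime_equation_of:
  assumes "ptime D e (\<lambda>i. enc_clause (c i))"
  shows "ptime D e (\<lambda>i. enc_equation (equation_of w (c i)))"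
proof -
  let ?enc = "\<lambda>b::bit. Num (of_bool (b = 1))"
  let ?D = "{p. fst p \<in> D}"
  let ?e = "\<lambda>p. Node (e (fst p)) (Node (?enc (fst (snd p))) (enc_literal (snd (snd p))))"
  \<comment> \<open>Adding 1 to a bit is negation of the Boolean that encodes it.\<close>
  have "ptime ?D ?e (\<lambda>p. if positive (snd (snd p)) then ?enc (fst (snd p)) else
      Num (of_bool (\<not> fst (snd p) = 1)))"
    by (intro ptime_if ptime_positive ptime_not ptime_subset[OF ptime_env_acc] ptime_env_elem) auto
  then have "ptime ?D ?e (\<lambda>p. ?enc (if positive (snd (snd p)) then fst (snd p) else fst (snd p) + 1))"
    by (rule ptime_cong) auto
  then have "ptime D e (\<lambda>i. ?enc (foldl (\<lambda>b l. if positive l then b else b + 1) 1 (c i)))"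
    by (rule ptime_foldl[OF assms, where B = "\<lambda>_. 1", rotated]) (simp_all add: ptime_Num poly_bounded_const)
  moreover have "ptime D e (\<lambda>i. enc_list Num (map var (c i)))"
    by (intro ptime_map[OF assms] ptime_var ptime_env_snd)
  ultimately show ?thesis
    unfolding equation_of_def enc_equation.simps by (intro ptime_Node ptime_Num)
qed

text \<open>For a clause of length at most 3, the three lists run through all its nonempty subsets.
  Since \<open>pairs\<close> lists each two-element subset in both orders, it gets half the
  weight.\<close>

definition equations :: "clause list \<Rightarrow> equation list" where
  "equations G = map (equation_of 2) (singletons G) @ map (equation_of 1) (pairs G)
     @ map (equation_of 2) (filter (\<lambda>c. length c = 3) G)"

lemma ptime_equations:
  assumes "ptime D e (\<lambda>i. enc_cnf (G i))"
  shows "ptime D e (\<lambda>i. enc_list enc_equation (equations (G i)))"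
proof -
  have "ptime D e (\<lambda>i. enc_cnf (filter (\<lambda>c. length c = 3) (G i)))"
    by (intro ptime_filter[OF assms] ptime_eq ptime_length[OF ptime_env_snd] ptime_Num)
  moreover have map_eqn: "ptime D e (\<lambda>i. enc_list enc_equation (map (equation_of w) (H i)))"
    if "ptime D e (\<lambda>i. enc_cnf (H i))" for H w
    by (intro ptime_map[OF that] ptime_equation_of ptime_env_snd)
  ultimately show ?thesis
    unfolding equations_def
    by (intro ptime_append map_eqn ptime_singletons[OF assms] ptime_pairs[OF assms])
qed

definition nontautological :: "clause \<Rightarrow> bool" where
  "nontautological c \<longleftrightarrow> \<not> (\<exists>l\<in>set c. \<exists>l'\<in>set c. var l = var l' \<and> l \<noteq> l')"

text \<open>The parameter is 2 per clause, the excess attained when all clauses are satisfied.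
  Writing it as the length of \<open>G @ G\<close> makes it computable by the available list
  functions.\<close>

definition lin_instance :: "clause list \<Rightarrow> nat \<times> equation list" where
  "lin_instance F = (let G = filter nontautological F in (length (G @ G), equations G))"

lemma ptime_lin_instance:
  assumes "ptime D e (\<lambda>i. enc_cnf (F i))"
  shows "ptime D e (\<lambda>i. encode max3lin2_aa (lin_instance (F i)))"
proof -
  have "ptime D e (\<lambda>i. enc_cnf (filter nontautological (F i)))"
    unfolding nontautological_def
    by (rule ptime_filter[OF assms] ptime_not ptime_Bex[OF ptime_env_snd]
      ptime_Bex[OF ptime_env[OF ptime_env_snd]] ptime_conj ptime_eq ptime_var ptime_literal_eq
      ptime_env_snd ptime_env[OF ptime_env_snd])+
  then have "ptime D e (\<lambda>i. let G = filter nontautological (F i)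
     in Node (Num (length (G @ G))) (enc_list enc_equation (equations G)))"
    unfolding Let_def by (intro ptime_Node ptime_length[OF ptime_append] ptime_equations)
  then show ?thesis
    by (simp add: lin_instance_def max3lin2_aa_def Let_def)
qed

text \<open>The root carries a tag: 1 announces the two children of an inner node, 0 the linear
  system of a leaf.\<close>

definition expand :: "nat \<Rightarrow> clause list \<Rightarrow> sexp" where
  "expand q F = (case find_heart q F of
     Some (h, j) \<Rightarrow> Node (Num 1) (Node (enc_cnf (h # F)) (enc_cnf (petals h j F @ F)))
   | None \<Rightarrow> Node (Num 0) (encode max3lin2_aa (lin_instance F)))"

lemma ptime_expand:
  assumes "ptime D e (\<lambda>i. enc_cnf (F i))"
  shows "ptime D e (\<lambda>i. expand q (F i))"
proof -
  let ?H = "\<lambda>\<theta> j H i. heavy \<theta> j (H (F i)) (F i)"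
  let ?branch = "\<lambda>\<theta> j H i. Node (Num 1) (Node (enc_cnf (hd (?H \<theta> j H i) # F i))
    (enc_cnf (petals (hd (?H \<theta> j H i)) j (F i) @ F i)))"
  have heavy: "ptime D' e (\<lambda>i. enc_cnf (?H \<theta> j H i))"
    if "H = singletons \<or> H = pairs" "D' \<subseteq> D" for \<theta> j H D'
    using that ptime_subset[OF assms that(2)]
    by (auto intro!: ptime_heavy ptime_singletons ptime_pairs)
  have branch: "ptime D' e (?branch \<theta> j H)"
    if H: "H = singletons \<or> H = pairs" and D': "D' \<subseteq> {i \<in> D. ?H \<theta> j H i \<noteq> []}" for \<theta> j H D'
  proof -
    have D: "D' \<subseteq> D" using D' by auto
    have "ptime D' e (\<lambda>i. enc_clause (hd (?H \<theta> j H i)))"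
      using D' by (intro ptime_hd heavy[OF H D]) auto
    then show ?thesis
      by (intro ptime_Node ptime_Num ptime_Cons ptime_append ptime_petals ptime_subset[OF assms] D)
  qed
  have "ptime D e (\<lambda>i.
     if ?H q 2 singletons i \<noteq> [] then ?branch q 2 singletons i
     else if ?H q 3 pairs i \<noteq> [] then ?branch q 3 pairs i
     else if ?H (q * q) 3 singletons i \<noteq> [] then ?branch (q * q) 3 singletons i
     else Node (Num 0) (encode max3lin2_aa (lin_instance (F i))))"
    by (intro ptime_if ptime_nonempty[where ex = enc_clause] heavy branch ptime_Node[OF ptime_Num]
      ptime_lin_instance ptime_subset[OF assms]) auto
  then show ?thesis
    by (rule ptime_cong) (auto simp: expand_def find_heart_def)
qed

section \<open>The potential of a family of clauses\<close>

definition antichain :: "'a set set \<Rightarrow> bool" where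
  "antichain S \<longleftrightarrow> (\<forall>c\<in>S. \<forall>c'\<in>S. \<not> c' \<subset> c)"

definition mins :: "'a set set \<Rightarrow> 'a set set" where
  "mins S = {c \<in> S. \<forall>c'\<in>S. \<not> c' \<subset> c}"

lemma mins_subset: "mins S \<subseteq> S"
  by (auto simp: mins_def)

lemma antichain_mins: "antichain (mins S)"
  by (auto simp: antichain_def mins_def)

lemma mins_antichain: "antichain S \<Longrightarrow> mins S = S"
  by (auto simp: antichain_def mins_def)

lemma mins_mins: "mins (mins S) = mins S"
  by (simp add: mins_antichain antichain_mins)

lemma mins_below:
  assumes "c \<in> S" "finite c" shows "\<exists>c'\<in>mins S. c' \<subseteq> c"
  using assms(2,1)
proof (induction c rule: finite_psubset_induct)
  case (psubset c)
  show ?case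
  proof (cases "c \<in> mins S")
    case False
    then obtain b where "b \<in> S" "b \<subset> c" using psubset.prems by (auto simp: mins_def)
    then show ?thesis using psubset.IH[of b] by blast
  qed blast
qed

text \<open>Hearts and petals lie strictly inside clauses of an antichain. Hence they are genuinely
  new, and no present clause subsumes them.\<close>

lemma antichain_no_subset:
  "antichain S \<Longrightarrow> c \<in> S \<Longrightarrow> n \<subset> c \<Longrightarrow> m \<in> S \<Longrightarrow> \<not> m \<subseteq> n"
  unfolding antichain_def by (meson subset_psubset_trans)

text \<open>The 2-clauses of the input formula are not counted: there may be quadratically many of them.\<close>

definition new_pairs :: "'a set set \<Rightarrow> 'a set set \<Rightarrow> 'a set set" where
  "new_pairs S\<^sub>0 S = {c \<in> mins S. card c = 2 \<and> c \<notin> S\<^sub>0}"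

definition units :: "'a set set \<Rightarrow> 'a set set" where
  "units S = {c \<in> mins S. card c = 1}"

text \<open>There are at most \<open>card L\<close> units, each counted \<open>4 * q\<close> times,
  and at most \<open>2 * q * card L\<close> new pairs because of the degree bound in
  \<open>admissible\<close>; hence the start value \<open>6 * q * card L\<close>. A new unit can
  subsume up to \<open>2 * q\<close> new pairs, so the factor \<open>4 * q\<close> leaves a net drop
  of \<open>2 * q\<close>.\<close>

definition potential :: "'a set \<Rightarrow> 'a set set \<Rightarrow> nat \<Rightarrow> 'a set set \<Rightarrow> int" where
  "potential L S\<^sub>0 q S =
     int (6 * q * card L) - int (4 * q * card (units S)) - int (card (new_pairs S\<^sub>0 S))"

text \<open>By the third condition every input clause remains subsumed. A pair that no present
  clause subsumes is therefore not an input clause and is counted by \<open>new_pairs\<close> once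
  it is added.\<close>

definition admissible :: "'a set \<Rightarrow> 'a set set \<Rightarrow> nat \<Rightarrow> 'a set set \<Rightarrow> bool" where
  "admissible L S\<^sub>0 q S \<longleftrightarrow>
     finite L \<and> (\<forall>c\<in>S. c \<subseteq> L \<and> card c \<le> 3) \<and> (\<forall>c\<in>S\<^sub>0. \<exists>c'\<in>S. c' \<subseteq> c)
     \<and> (\<forall>l. card {c \<in> new_pairs S\<^sub>0 S. l \<in> c} \<le> 2 * q)"

lemma admissible_finite:
  assumes "admissible L S\<^sub>0 q S" shows "finite S" "c \<in> S \<Longrightarrow> finite c"
proof -
  have "finite L" "S \<subseteq> Pow L" using assms by (auto simp: admissible_def)
  then show "finite S" "c \<in> S \<Longrightarrow> finite c"
    by (auto intro: finite_subset)
qed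

lemma finite_new_pairs: "finite S \<Longrightarrow> finite (new_pairs S\<^sub>0 S)"
  using finite_subset[OF mins_subset[of S]] by (simp add: new_pairs_def)

lemma finite_units: "finite S \<Longrightarrow> finite (units S)"
  using finite_subset[OF mins_subset[of S]] by (simp add: units_def)

lemma new_pairs_mins: "new_pairs S\<^sub>0 (mins S) = new_pairs S\<^sub>0 S"
  by (simp add: new_pairs_def mins_mins)

lemma potential_mins: "potential L S\<^sub>0 q (mins S) = potential L S\<^sub>0 q S"
  by (simp add: potential_def units_def mins_mins new_pairs_mins)

lemma admissible_mins: assumes "admissible L S\<^sub>0 q S" shows "admissible L S\<^sub>0 q (mins S)"
  unfolding admissible_def new_pairs_mins
proof (intro conjI ballI)
  show "finite L" "\<forall>l. card {c \<in> new_pairs S\<^sub>0 S. l \<in> c} \<le> 2 * q"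
    using assms by (simp_all add: admissible_def)
  show "c \<subseteq> L" "card c \<le> 3" if "c \<in> mins S" for c
    using assms that by (simp_all add: admissible_def mins_def)
  fix c assume "c \<in> S\<^sub>0"
  then obtain b where b: "b \<in> S" "b \<subseteq> c" using assms unfolding admissible_def by metis
  from mins_below[OF b(1) admissible_finite(2)[OF assms b(1)]] b(2)
  show "\<exists>c'\<in>mins S. c' \<subseteq> c" by (meson order_trans)
qed

lemma potential_nonneg:
  assumes "admissible L S\<^sub>0 q S" shows "0 \<le> potential L S\<^sub>0 q S"
proof -
  have L: "finite L" and sub: "\<And>c. c \<in> mins S \<Longrightarrow> c \<subseteq> L"
    and deg: "\<And>l. card {c \<in> new_pairs S\<^sub>0 S. l \<in> c} \<le> 2 * q"
    using assms by (auto simp: admissible_def mins_def)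
  have "units S \<subseteq> (\<lambda>l. {l}) ` L"
    using sub by (force simp: units_def card_1_singleton_iff)
  then have "card (units S) \<le> card L"
    using L by (meson card_image_le card_mono finite_imageI le_trans)
  then have "4 * q * card (units S) \<le> 4 * q * card L" by (rule mult_left_mono) simp
  moreover have "card (new_pairs S\<^sub>0 S) \<le> 2 * q * card L"
  proof -
    have "new_pairs S\<^sub>0 S \<subseteq> (\<Union>l\<in>L. {c \<in> new_pairs S\<^sub>0 S. l \<in> c})"
    proof
      fix c assume c: "c \<in> new_pairs S\<^sub>0 S"
      then obtain l where "l \<in> c" by (fastforce simp: new_pairs_def)
      with c sub[of c] show "c \<in> (\<Union>l\<in>L. {c \<in> new_pairs S\<^sub>0 S. l \<in> c})"
        by (auto simp: new_pairs_def)
    qed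
    then have "card (new_pairs S\<^sub>0 S) \<le> card (\<Union>l\<in>L. {c \<in> new_pairs S\<^sub>0 S. l \<in> c})"
      using L finite_new_pairs[OF admissible_finite(1)[OF assms]] by (intro card_mono) auto
    also have "\<dots> \<le> (\<Sum>l\<in>L. card {c \<in> new_pairs S\<^sub>0 S. l \<in> c})"
      using L by (rule card_UN_le)
    also have "\<dots> \<le> (\<Sum>l\<in>L. 2 * q)" by (intro sum_mono deg)
    finally show ?thesis by (simp add: mult.commute)
  qed
  ultimately have "4 * q * card (units S) + card (new_pairs S\<^sub>0 S) \<le> 6 * q * card L"
    by linarith
  then show ?thesis unfolding potential_def by linarith
qed

text \<open>Old units stay minimal and each element of \<open>U\<close> contributes a further one.
  Only new pairs meeting \<open>U\<close> are lost, at most \<open>2 * q\<close> per element,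
  against the gain of \<open>4 * q\<close>.\<close>

lemma admissible_add_units:
  assumes adm: "admissible L S\<^sub>0 q S" and S: "antichain S"
    and U: "\<And>l. l \<in> U \<Longrightarrow> \<exists>c\<in>S. {l} \<subset> c"
  defines "S' \<equiv> S \<union> (\<lambda>l. {l}) ` U"
  shows "admissible L S\<^sub>0 q S'"
    and "potential L S\<^sub>0 q S' + int (2 * q * card U) \<le> potential L S\<^sub>0 q S"
proof -
  note fin = admissible_finite[OF adm]
  have L: "finite L" and sub: "\<And>c. c \<in> S \<Longrightarrow> c \<subseteq> L \<and> card c \<le> 3"
    and deg: "\<And>l. card {c \<in> new_pairs S\<^sub>0 S. l \<in> c} \<le> 2 * q"
    using adm by (simp_all add: admissible_def)
  have UL: "U \<subseteq> L" using U sub by blast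
  then have finU: "finite U" using L finite_subset by blast
  have new: "\<not> c \<subseteq> {l}" if l: "l \<in> U" and c: "c \<in> S" for l c
  proof -
    obtain c' where "c' \<in> S" "{l} \<subset> c'" using U[OF l] by blast
    from antichain_no_subset[OF S this c] show ?thesis .
  qed
  have not_psub: "\<not> c' \<subset> {l}" if "l \<in> U" "c' \<in> S'" for c' l
    using that new[OF that(1)] unfolding S'_def by blast
  have units: "units S \<union> (\<lambda>l. {l}) ` U \<subseteq> units S'"
  proof
    fix c assume "c \<in> units S \<union> (\<lambda>l. {l}) ` U"
    then show "c \<in> units S'"
    proof
      \<comment> \<open>Only the empty set lies strictly below a singleton. It is not among the
        added sets, so it would already have prevented \<open>c\<close> from being minimal in
        \<open>S\<close>.\<close>
      assume c: "c \<in> units S"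
      then have "c \<in> S" by (simp add: units_def mins_def)
      moreover have "\<not> c' \<subset> c" if "c' \<in> S'" for c'
      proof
        assume sub: "c' \<subset> c"
        obtain l where "c = {l}" using c by (auto simp: units_def card_1_singleton_iff)
        with sub have "c' = {}" by blast
        then show False using sub c that by (auto simp: units_def mins_def S'_def)
      qed
      ultimately show ?thesis using c by (simp add: units_def mins_def S'_def)
    next
      assume "c \<in> (\<lambda>l. {l}) ` U"
      then obtain l where "l \<in> U" "c = {l}" by blast
      then show ?thesis using not_psub[of l] by (simp add: units_def mins_def S'_def)
    qed
  qed
  have "finite S'" unfolding S'_def using fin finU by simp
  have "card (units S) + card U = card (units S \<union> (\<lambda>l. {l}) ` U)"
  proof -
    have "units S \<inter> (\<lambda>l. {l}) ` U = {}"
      using new by (fastforce simp: units_def mins_def)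
    then show ?thesis
      using finite_units[OF fin(1)] finU by (subst card_Un_disjoint) (auto simp: card_image)
  qed
  also have "\<dots> \<le> card (units S')"
    using units finite_units[OF \<open>finite S'\<close>] by (intro card_mono)
  finally have card_units: "card (units S) + card U \<le> card (units S')" .
  have sub_pairs: "new_pairs S\<^sub>0 S' \<subseteq> new_pairs S\<^sub>0 S"
    by (auto simp: new_pairs_def mins_def S'_def)
  \<comment> \<open>A pair ceases to be minimal only if it contains an added singleton.\<close>
  have "new_pairs S\<^sub>0 S \<subseteq> new_pairs S\<^sub>0 S' \<union> (\<Union>l\<in>U. {c \<in> new_pairs S\<^sub>0 S. l \<in> c})"
    by (auto simp: new_pairs_def mins_def S'_def)
  then have "card (new_pairs S\<^sub>0 S)
      \<le> card (new_pairs S\<^sub>0 S' \<union> (\<Union>l\<in>U. {c \<in> new_pairs S\<^sub>0 S. l \<in> c}))"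
    using finU finite_new_pairs[OF fin(1), of S\<^sub>0] finite_new_pairs[OF \<open>finite S'\<close>, of S\<^sub>0]
    by (intro card_mono) auto
  also have "\<dots> \<le> card (new_pairs S\<^sub>0 S') + card (\<Union>l\<in>U. {c \<in> new_pairs S\<^sub>0 S. l \<in> c})"
    by (rule card_Un_le)
  also have "card (\<Union>l\<in>U. {c \<in> new_pairs S\<^sub>0 S. l \<in> c}) \<le> (\<Sum>l\<in>U. card {c \<in> new_pairs S\<^sub>0 S. l \<in> c})"
    using finU by (rule card_UN_le)
  also have "\<dots> \<le> (\<Sum>l\<in>U. 2 * q)" by (intro sum_mono deg)
  finally have "card (new_pairs S\<^sub>0 S) \<le> card (new_pairs S\<^sub>0 S') + 2 * q * card U"
    by (simp add: mult.commute)
  moreover have "4 * q * (card (units S) + card U) \<le> 4 * q * card (units S')"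
    using card_units by (intro mult_left_mono) auto
  ultimately have "4 * q * card (units S) + card (new_pairs S\<^sub>0 S) + 2 * q * card U
      \<le> 4 * q * card (units S') + card (new_pairs S\<^sub>0 S')"
    by (simp add: algebra_simps)
  then show "potential L S\<^sub>0 q S' + int (2 * q * card U) \<le> potential L S\<^sub>0 q S"
    unfolding potential_def by linarith
  have "card {c \<in> new_pairs S\<^sub>0 S'. l \<in> c} \<le> 2 * q" for l
  proof -
    have "card {c \<in> new_pairs S\<^sub>0 S'. l \<in> c} \<le> card {c \<in> new_pairs S\<^sub>0 S. l \<in> c}"
      using sub_pairs finite_new_pairs[OF fin(1), of S\<^sub>0] by (intro card_mono) auto
    with deg[of l] show ?thesis by linarith
  qed
  moreover have "\<exists>c'\<in>S'. c' \<subseteq> c" if "c \<in> S\<^sub>0" for c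
    using adm that unfolding admissible_def S'_def by (meson UnI1)
  moreover have "c \<subseteq> L \<and> card c \<le> 3" if "c \<in> S'" for c
    using that sub UL by (auto simp: S'_def)
  ultimately show "admissible L S\<^sub>0 q S'"
    using L by (simp add: admissible_def)
qed

text \<open>A two-element set subsumes strictly only larger sets, so the units and pairs that were
  minimal stay minimal. The members of \<open>N\<close> are minimal because they lie strictly inside
  clauses of an antichain, so each of them counts once.\<close>

lemma admissible_add_pairs:
  assumes adm: "admissible L S\<^sub>0 q S" and S: "antichain S"
    and N: "\<And>n. n \<in> N \<Longrightarrow> card n = 2 \<and> (\<exists>c\<in>S. n \<subset> c)"
    and degN: "\<And>l. card {c \<in> new_pairs S\<^sub>0 S. l \<in> c} + card {n \<in> N. l \<in> n} \<le> 2 * q"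
  defines "S' \<equiv> S \<union> N"
  shows "admissible L S\<^sub>0 q S'"
    and "potential L S\<^sub>0 q S' + int (card N) \<le> potential L S\<^sub>0 q S"
proof -
  note fin = admissible_finite[OF adm]
  have L: "finite L" and sub: "\<And>c. c \<in> S \<Longrightarrow> c \<subseteq> L \<and> card c \<le> 3"
    using adm by (simp_all add: admissible_def)
  have "N \<subseteq> Pow L" using N sub by blast
  then have finN: "finite N" using L finite_subset by blast
  have finS': "finite S'" unfolding S'_def using fin finN by simp
  have new: "\<not> c \<subseteq> n" if n: "n \<in> N" and c: "c \<in> S" for n c
  proof -
    obtain c' where "c' \<in> S" "n \<subset> c'" using N[OF n] by blast
    from antichain_no_subset[OF S this c] show ?thesis .
  qed
  have N_card: "\<not> n \<subset> n'" if "n \<in> N" "card n' \<le> 2" "finite n'" for n n'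
    using that N[OF that(1)] psubset_card_mono[of n' n] by linarith
  have finn: "finite n" if "n \<in> N" for n
    using N[OF that] by (intro card_ge_0_finite) simp
  have mins_S': "c \<in> mins S' \<longleftrightarrow> c \<in> S" if "card c \<le> 2" "finite c" "c \<notin> N" for c
    using N_card[OF _ that(1,2)] S that(3) by (auto simp: mins_def S'_def antichain_def)
  have N_mins: "n \<in> mins S'" if "n \<in> N" for n
    using N_card[of _ n] N[OF that] finn[OF that] new[OF that] that
    by (auto simp: mins_def S'_def)
  have mins_S: "mins S = S" using S by (rule mins_antichain)
  have "finite c" if "card c = Suc k" for c :: "'a set" and k
    using that by (intro card_ge_0_finite) simp
  then have fin_card: "finite c" if "card c = 1 \<or> card c = 2" for c :: "'a set"
    using that by (auto simp: numeral_2_eq_2)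
  have "c \<in> mins S' \<longleftrightarrow> c \<in> S" if "card c = 1" for c
  proof (rule mins_S')
    show "c \<notin> N"
    proof
      assume "c \<in> N"
      then have "card c = 2" using N by blast
      with that show False by simp
    qed
    show "card c \<le> 2" using that by linarith
    show "finite c" using that fin_card by blast
  qed
  then have "(c \<in> mins S' \<and> card c = 1) = (c \<in> S \<and> card c = 1)" for c by metis
  then have units: "units S' = units S" unfolding units_def mins_S by (rule Collect_cong)
  \<comment> \<open>An input clause would have a present clause inside it, which is impossible for
    members of \<open>N\<close>.\<close>
  have N_new: "n \<notin> S\<^sub>0" if n: "n \<in> N" for n
  proof
    assume "n \<in> S\<^sub>0"
    then obtain c' where "c' \<in> S" "c' \<subseteq> n" using adm unfolding admissible_def by metis
    then show False using new[OF n] by blast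
  qed
  have "c \<in> new_pairs S\<^sub>0 S' \<longleftrightarrow> c \<in> new_pairs S\<^sub>0 S \<union> N" for c
  proof (cases "c \<in> N")
    case True
    with N_new[OF True] N_mins[OF True] N[OF True] show ?thesis
      unfolding new_pairs_def by blast
  next
    case False
    have "c \<in> mins S' \<longleftrightarrow> c \<in> S" if "card c = 2"
    proof (rule mins_S')
      show "card c \<le> 2" using that by linarith
      show "finite c" using that fin_card by blast
    qed (fact False)
    with False show ?thesis unfolding new_pairs_def mins_S by blast
  qed
  then have pairs: "new_pairs S\<^sub>0 S' = new_pairs S\<^sub>0 S \<union> N" by (rule set_eqI)
  have "c \<notin> N" if "c \<in> new_pairs S\<^sub>0 S" for c
    using new[of c c] that by (auto simp: new_pairs_def mins_S)
  then have "new_pairs S\<^sub>0 S \<inter> N = {}" by blast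
  then have "card (new_pairs S\<^sub>0 S') = card (new_pairs S\<^sub>0 S) + card N"
    unfolding pairs using finite_new_pairs[OF fin(1)] finN by (intro card_Un_disjoint)
  then show "potential L S\<^sub>0 q S' + int (card N) \<le> potential L S\<^sub>0 q S"
    unfolding potential_def units by linarith
  have "card {c \<in> new_pairs S\<^sub>0 S'. l \<in> c} \<le> 2 * q" for l
  proof -
    have "{c \<in> new_pairs S\<^sub>0 S'. l \<in> c} = {c \<in> new_pairs S\<^sub>0 S. l \<in> c} \<union> {n \<in> N. l \<in> n}"
      unfolding pairs by auto
    then show ?thesis
      using degN[of l] card_Un_le[of "{c \<in> new_pairs S\<^sub>0 S. l \<in> c}" "{n \<in> N. l \<in> n}"] by simp
  qed
  moreover have "\<exists>c'\<in>S'. c' \<subseteq> c" if "c \<in> S\<^sub>0" for c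
    using adm that unfolding admissible_def S'_def by (meson UnI1)
  moreover have "c \<subseteq> L \<and> card c \<le> 3" if "c \<in> S'" for c
  proof (cases "c \<in> N")
    case True
    then have "c \<subseteq> L" "card c = 2" using \<open>N \<subseteq> Pow L\<close> N by blast+
    then show ?thesis by linarith
  next
    case False
    then show ?thesis using that sub unfolding S'_def by blast
  qed
  ultimately show "admissible L S\<^sub>0 q S'"
    using L by (simp add: admissible_def)
qed

section \<open>Sunflowers and the drop of the potential\<close>

definition sunflower :: "'a set set \<Rightarrow> 'a set \<Rightarrow> nat \<Rightarrow> 'a set set" where
  "sunflower S h j = {c \<in> S. card c = j \<and> h \<subseteq> c}"

definition petal_sets :: "'a set set \<Rightarrow> 'a set \<Rightarrow> nat \<Rightarrow> 'a set set" where
  "petal_sets S h j = (\<lambda>c. c - h) ` sunflower S h j"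

lemma card_petal_sets: "card (petal_sets S h j) = card (sunflower S h j)"
  unfolding petal_sets_def by (intro card_image inj_onI) (auto simp: sunflower_def)

lemma petal_setsD:
  assumes "n \<in> petal_sets S h j" "h \<noteq> {}" "0 < j"
  shows "card n = j - card h" "\<exists>c\<in>S. n \<subset> c"
proof -
  obtain c where c: "c \<in> S" "card c = j" "h \<subseteq> c" "n = c - h"
    using assms(1) by (auto simp: petal_sets_def sunflower_def)
  then have "finite h" using assms(3) by (metis card.infinite finite_subset less_irrefl)
  with c show "card n = j - card h" by (simp add: card_Diff_subset)
  show "\<exists>c\<in>S. n \<subset> c" using c assms(2) by blast
qed

lemma petal_sets_singletons:
  assumes "h \<noteq> {}" "card h + 1 = j"
  shows "\<exists>U. petal_sets S h j = (\<lambda>l. {l}) ` U \<and> card U = card (sunflower S h j)"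
proof (intro exI conjI)
  let ?U = "{l. {l} \<in> petal_sets S h j}"
  have "\<exists>l. n = {l}" if "n \<in> petal_sets S h j" for n
  proof -
    have "card n = 1" using petal_setsD(1)[OF that assms(1)] assms(2) by linarith
    then show ?thesis by (simp add: card_1_singleton_iff)
  qed
  then show eq: "petal_sets S h j = (\<lambda>l. {l}) ` ?U" by auto
  have "card ((\<lambda>l. {l}) ` ?U) = card ?U" by (intro card_image) auto
  then show "card ?U = card (sunflower S h j)" using eq card_petal_sets by metis
qed

definition decreases :: "'a set \<Rightarrow> 'a set set \<Rightarrow> nat \<Rightarrow> 'a set set \<Rightarrow> nat \<Rightarrow> 'a set set \<Rightarrow> bool" where
  "decreases L S\<^sub>0 q S d S' \<longleftrightarrow>
     admissible L S\<^sub>0 q S' \<and> potential L S\<^sub>0 q S' + int d \<le> potential L S\<^sub>0 q S"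

lemma decreases_weaken: "decreases L S\<^sub>0 q S d S' \<Longrightarrow> d' \<le> d \<Longrightarrow> decreases L S\<^sub>0 q S d' S'"
  by (auto simp: decreases_def)

lemma decreases_units:
  assumes "admissible L S\<^sub>0 q S" "antichain S" "\<And>l. l \<in> U \<Longrightarrow> \<exists>c\<in>S. {l} \<subset> c"
  shows "decreases L S\<^sub>0 q S (2 * q * card U) (S \<union> (\<lambda>l. {l}) ` U)"
  unfolding decreases_def using admissible_add_units[OF assms] by blast

text \<open>Covers both hearts whose petals are single literals: a literal in 2-clauses and a pair
  in 3-clauses. Each of at least \<open>q\<close> petals lowers the potential by
  \<open>2 * q\<close>.\<close>

lemma decreases_petal_units:
  assumes adm: "admissible L S\<^sub>0 q S" "antichain S" and h: "h \<noteq> {}" "card h + 1 = j"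
    and q: "q \<le> card (sunflower S h j)"
  shows "decreases L S\<^sub>0 q S (q * q) (S \<union> petal_sets S h j)"
proof -
  obtain U where U: "petal_sets S h j = (\<lambda>l. {l}) ` U" "card U = card (sunflower S h j)"
    using petal_sets_singletons[OF h] by blast
  have "\<exists>c\<in>S. {l} \<subset> c" if "l \<in> U" for l
    using petal_setsD(2)[of "{l}" S h j] h U that by auto
  from decreases_units[OF adm this] have "decreases L S\<^sub>0 q S (2 * q * card U) (S \<union> petal_sets S h j)"
    unfolding U(1) by simp
  moreover have "q * q \<le> 2 * q * card U" using q U(2) by (simp add: mult_le_mono)
  ultimately show ?thesis by (rule decreases_weaken)
qed

lemma decreases_unit_heart:
  assumes adm: "admissible L S\<^sub>0 q S" "antichain S" and q: "0 < q"
    and c: "c \<in> sunflower S {l} j" "1 < j"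
  shows "decreases L S\<^sub>0 q S 1 (S \<union> {{l}})"
proof -
  have "\<exists>c\<in>S. {l} \<subset> c" using c by (force simp: sunflower_def)
  then have "decreases L S\<^sub>0 q S (2 * q * card {l}) (S \<union> (\<lambda>l. {l}) ` {l})"
    by (intro decreases_units adm) auto
  then show ?thesis using q by (intro decreases_weaken[where d' = 1]) auto
qed

lemma new_pairs_degree:
  assumes "finite S" shows "card {c \<in> new_pairs S\<^sub>0 S. l \<in> c} \<le> card (sunflower S {l} 2)"
  using assms by (intro card_mono) (auto simp: new_pairs_def mins_def sunflower_def)

text \<open>Since every literal lies in fewer than \<open>q\<close> clauses of length 2, the degree
  bound \<open>2 * q\<close> leaves room for one more pair.\<close>

lemma decreases_pair_heart:
  assumes adm: "admissible L S\<^sub>0 q S" "antichain S"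
    and light: "\<And>l. card (sunflower S {l} 2) < q"
    and h: "card h = 2" "c \<in> sunflower S h 3"
  shows "decreases L S\<^sub>0 q S 1 (S \<union> {h})"
proof -
  have "c \<in> S" "h \<subset> c" using h by (auto simp: sunflower_def)
  then have "\<exists>c\<in>S. h \<subset> c" by blast
  moreover have "card {c \<in> new_pairs S\<^sub>0 S. l \<in> c} + card {n \<in> {h}. l \<in> n} \<le> 2 * q" for l
  proof -
    have "card {n \<in> {h}. l \<in> n} \<le> card {h}" by (intro card_mono) auto
    then show ?thesis
      using new_pairs_degree[OF admissible_finite(1)[OF adm(1)], of S\<^sub>0 l] light[of l] by simp
  qed
  ultimately have "decreases L S\<^sub>0 q S (card {h}) (S \<union> {h})"
    unfolding decreases_def using h(1) admissible_add_pairs[OF adm, of "{h}"] by simp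
  then show ?thesis by simp
qed

text \<open>The origin of the degree bound \<open>2 * q\<close>. A literal lies in fewer than
  \<open>q\<close> old pairs, and a petal containing \<open>l'\<close> comes from a 3-clause
  containing both \<open>l\<close> and \<open>l'\<close>, of which there are fewer than
  \<open>q\<close> because no pair is heavy.\<close>

lemma decreases_petal_pairs:
  assumes adm: "admissible L S\<^sub>0 q S" "antichain S"
    and light: "\<And>l. card (sunflower S {l} 2) < q" "\<And>h. card h = 2 \<Longrightarrow> card (sunflower S h 3) < q"
    and q: "q * q \<le> card (sunflower S {l} 3)"
  shows "decreases L S\<^sub>0 q S (q * q) (S \<union> petal_sets S {l} 3)"
proof -
  let ?N = "petal_sets S {l} 3"
  have fin: "finite S" using admissible_finite(1)[OF adm(1)] .
  have "card n = 2 \<and> (\<exists>c\<in>S. n \<subset> c)" if "n \<in> ?N" for n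
    using petal_setsD[OF that] by simp
  moreover have "card {c \<in> new_pairs S\<^sub>0 S. l' \<in> c} + card {n \<in> ?N. l' \<in> n} \<le> 2 * q" for l'
  proof -
    have "card {n \<in> ?N. l' \<in> n} \<le> q"
    proof (cases "l' = l")
      case True
      then have "{n \<in> ?N. l' \<in> n} = {}" by (auto simp: petal_sets_def)
      then show ?thesis by (simp only: card.empty)
    next
      case False
      have "{n \<in> ?N. l' \<in> n} \<subseteq> (\<lambda>c. c - {l}) ` sunflower S {l, l'} 3"
        by (auto simp: petal_sets_def sunflower_def)
      moreover have "finite (sunflower S {l, l'} 3)" using fin by (simp add: sunflower_def)
      ultimately have "card {n \<in> ?N. l' \<in> n} \<le> card (sunflower S {l, l'} 3)"
        by (meson card_image_le card_mono finite_imageI le_trans)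
      then show ?thesis using light(2)[of "{l, l'}"] False by simp
    qed
    then show ?thesis using new_pairs_degree[OF fin, of S\<^sub>0 l'] light(1)[of l'] by simp
  qed
  ultimately have "decreases L S\<^sub>0 q S (card ?N) (S \<union> ?N)"
    unfolding decreases_def using admissible_add_pairs[OF adm, of ?N] by blast
  then show ?thesis
    using q card_petal_sets[of S "{l}" 3] by (intro decreases_weaken[where d' = "q * q"]) auto
qed

text \<open>Counting by size: one empty clause, at most \<open>card L\<close> units, and every
  larger clause is charged to one of its literals.\<close>

lemma card_sparse_family:
  assumes L: "finite L" "\<And>c. c \<in> S \<Longrightarrow> c \<subseteq> L \<and> card c \<le> 3"
    and sparse: "\<And>l. card (sunflower S {l} 2) \<le> q" "\<And>l. card (sunflower S {l} 3) \<le> q * q"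
  shows "card S \<le> 1 + card L * (1 + q + q * q)"
proof -
  have fin: "finite S"
    using L(2) by (intro finite_subset[OF _ finite_Pow_iff[THEN iffD2, OF L(1)]]) blast
  let ?P = "\<lambda>j. \<Union>l\<in>L. sunflower S {l} j"
  have P: "c \<in> ?P (card c)" if "c \<in> S" "c \<noteq> {}" for c
    using that L(2)[of c] by (auto simp: sunflower_def)
  have "S \<subseteq> {{}} \<union> ((\<lambda>l. {l}) ` L \<union> (?P 2 \<union> ?P 3))"
  proof
    fix c assume c: "c \<in> S"
    then have "finite c" using L finite_subset by blast
    then have "c = {} \<or> card c = 1 \<or> card c = 2 \<or> card c = 3"
      using L(2)[OF c] card_0_eq[OF \<open>finite c\<close>] by linarith
    then show "c \<in> {{}} \<union> ((\<lambda>l. {l}) ` L \<union> (?P 2 \<union> ?P 3))"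
    proof (elim disjE)
      assume "card c = 1"
      then show ?thesis using L(2)[OF c] by (auto simp: card_1_singleton_iff)
    next
      assume "card c = 2"
      moreover from this have "c \<noteq> {}" by auto
      ultimately show ?thesis using P[OF c] by simp
    next
      assume "card c = 3"
      moreover from this have "c \<noteq> {}" by auto
      ultimately show ?thesis using P[OF c] by simp
    qed simp
  qed
  then have "card S \<le> card ({{}} \<union> ((\<lambda>l. {l}) ` L \<union> (?P 2 \<union> ?P 3)))"
    using L(1) fin by (intro card_mono) (auto simp: sunflower_def)
  also have "\<dots> \<le> card {{}::'a set} + (card ((\<lambda>l. {l}) ` L) + (card (?P 2) + card (?P 3)))"
    by (intro order.trans[OF card_Un_le] add_left_mono order.refl)
  also have "\<dots> \<le> 1 + (card L + (card L * q + card L * (q * q)))"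
  proof (intro add_mono)
    have "card (?P j) \<le> card L * b" if "\<And>l. card (sunflower S {l} j) \<le> b" for j b
      using card_UN_le[OF L(1), of "\<lambda>l. sunflower S {l} j"] sum_mono[of L _ "\<lambda>_. b", OF that]
      by (fastforce intro: order.trans)
    then show "card (?P 2) \<le> card L * q" "card (?P 3) \<le> card L * (q * q)"
      using sparse by blast+
  qed (auto simp: card_image_le L(1))
  finally show ?thesis by (simp add: algebra_simps)
qed

section \<open>Correctness of the branching\<close>

abbreviation clause_sets :: "clause list \<Rightarrow> literal set set" where
  "clause_sets F \<equiv> set ` set F"

text \<open>The distinctness conditions make lengths of lists equal to the cardinalities that the
  potential and the thresholds refer to.\<close>

definition state_ok :: "literal set \<Rightarrow> literal set set \<Rightarrow> nat \<Rightarrow> clause list \<Rightarrow> bool" where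
  "state_ok L S\<^sub>0 q F \<longleftrightarrow>
     (\<forall>c\<in>set F. distinct c) \<and> distinct (map set F) \<and> admissible L S\<^sub>0 q (clause_sets F)"

lemma clause_sets_reduce: "clause_sets (reduce F) = mins (clause_sets F)"
  by (auto simp: reduce_def mins_def)

lemma state_ok_reduce:
  assumes "state_ok L S\<^sub>0 q F" shows "state_ok L S\<^sub>0 q (reduce F)"
proof -
  have "distinct (map set (reduce F))"
    using assms by (simp add: state_ok_def reduce_def distinct_map_filter)
  moreover have "\<forall>c\<in>set (reduce F). distinct c"
    using assms by (simp add: state_ok_def reduce_def)
  ultimately show ?thesis
    using assms by (simp add: state_ok_def clause_sets_reduce admissible_mins)
qed

section \<open>Satisfiability under reduction and branching\<close>

lemma satisfiable_clause_sets:
  "satisfiable F \<longleftrightarrow> (\<exists>\<alpha>. \<forall>C\<in>clause_sets F. \<exists>l\<in>C. satisfies_literal \<alpha> l)"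
  by (simp add: satisfiable_def)

lemma satisfiable_reduce: "satisfiable (reduce F) \<longleftrightarrow> satisfiable F"
proof -
  have "(\<forall>C\<in>mins (clause_sets F). \<exists>l\<in>C. satisfies_literal \<alpha> l)
      \<longleftrightarrow> (\<forall>C\<in>clause_sets F. \<exists>l\<in>C. satisfies_literal \<alpha> l)" (is "?l \<longleftrightarrow> ?r") for \<alpha>
  proof
    assume l: ?l
    show ?r
    proof
      fix C assume "C \<in> clause_sets F"
      then obtain C' where C': "C' \<in> mins (clause_sets F)" "C' \<subseteq> C"
        using mins_below[of C "clause_sets F"] by auto
      obtain l where "l \<in> C'" "satisfies_literal \<alpha> l" using l C'(1) by blast
      then show "\<exists>l\<in>C. satisfies_literal \<alpha> l" using C'(2) by blast
    qed
  qed (auto simp: mins_def)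
  then show ?thesis unfolding satisfiable_clause_sets clause_sets_reduce by simp
qed

lemma satisfiable_branch:
  "satisfiable F \<longleftrightarrow> satisfiable (h # F) \<or> satisfiable (petals h j F @ F)"
proof
  assume "satisfiable F"
  then obtain \<alpha> where \<alpha>: "\<forall>c\<in>set F. \<exists>l\<in>set c. satisfies_literal \<alpha> l"
    by (auto simp: satisfiable_def)
  show "satisfiable (h # F) \<or> satisfiable (petals h j F @ F)"
  proof (cases "\<exists>l\<in>set h. satisfies_literal \<alpha> l")
    case True
    with \<alpha> show ?thesis unfolding satisfiable_def by (intro disjI1 exI[of _ \<alpha>]) simp
  next
    case False
    have "\<exists>l\<in>set c. satisfies_literal \<alpha> l" if "c \<in> set (petals h j F)" for c
    proof -
      obtain c' where c': "c' \<in> set F" "c = filter (\<lambda>l. l \<notin> set h) c'"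
        using \<open>c \<in> set (petals h j F)\<close> by (auto simp: petals_def flower_def)
      then obtain l where "l \<in> set c'" "satisfies_literal \<alpha> l" using \<alpha> by blast
      with False c'(2) show ?thesis by auto
    qed
    with \<alpha> show ?thesis unfolding satisfiable_def by (intro disjI2 exI[of _ \<alpha>]) auto
  qed
next
  show "satisfiable (h # F) \<or> satisfiable (petals h j F @ F) \<Longrightarrow> satisfiable F"
    by (auto simp: satisfiable_def)
qed

section \<open>From clause lists to families of literal sets\<close>

lemma clause_sets_flower:
  assumes "\<forall>c\<in>set F. distinct c"
  shows "clause_sets (flower h j F) = sunflower (clause_sets F) (set h) j"
proof -
  have "set (flower h j F) = {c \<in> set F. card (set c) = j \<and> set h \<subseteq> set c}"
    using assms by (auto simp: flower_def distinct_card)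
  then show ?thesis by (auto simp: sunflower_def)
qed

lemma length_flower:
  assumes "state_ok L S\<^sub>0 q F"
  shows "length (flower h j F) = card (sunflower (clause_sets F) (set h) j)"
proof -
  have F: "\<forall>c\<in>set F. distinct c" "distinct (map set F)"
    using assms by (simp_all add: state_ok_def)
  have "distinct (map set (flower h j F))"
    using F by (simp add: flower_def distinct_map_filter)
  from distinct_card[OF this] show ?thesis
    using clause_sets_flower[OF F(1)] by simp
qed

lemma clause_sets_petals:
  assumes "\<forall>c\<in>set F. distinct c"
  shows "clause_sets (petals h j F) = petal_sets (clause_sets F) (set h) j"
proof -
  have "clause_sets (petals h j F) = (\<lambda>C. C - set h) ` clause_sets (flower h j F)"
    by (auto simp: petals_def image_image)
  then show ?thesis unfolding petal_sets_def clause_sets_flower[OF assms] .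
qed

text \<open>Only distinctness needs an argument: \<open>set h\<close> lies strictly inside a clause
  of an antichain, hence is not itself a clause.\<close>

lemma state_ok_Cons:
  assumes F: "state_ok L S\<^sub>0 q F" "antichain (clause_sets F)"
    and h: "distinct h" "h \<noteq> []" "c \<in> sunflower (clause_sets F) (set h) j" "length h < j"
    and dec: "decreases L S\<^sub>0 q (clause_sets F) d (clause_sets F \<union> {set h})"
  shows "state_ok L S\<^sub>0 q (h # F)"
proof -
  have "c \<in> clause_sets F" "set h \<subset> c"
    using h(3,4) distinct_card[OF h(1)] by (auto simp: sunflower_def)
  then have "set h \<notin> clause_sets F"
    using F(2) unfolding antichain_def by blast
  then show ?thesis
    using F(1) h(1) dec by (auto simp: state_ok_def decreases_def)
qed

lemma state_ok_petals:
  assumes F: "state_ok L S\<^sub>0 q F" "antichain (clause_sets F)"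
    and h: "h \<noteq> []" "0 < j"
    and dec: "decreases L S\<^sub>0 q (clause_sets F) d (clause_sets F \<union> petal_sets (clause_sets F) (set h) j)"
  shows "state_ok L S\<^sub>0 q (petals h j F @ F)"
proof -
  have dist: "\<forall>c\<in>set F. distinct c" "distinct (map set F)"
    using F(1) by (simp_all add: state_ok_def)
  have "map set (petals h j F) = map (\<lambda>C. C - set h) (map set (flower h j F))"
    by (auto simp: petals_def)
  \<comment> \<open>All clauses of the flower contain \<open>h\<close>, so each is recovered from
    its petal.\<close>
  moreover have "distinct (map (\<lambda>C. C - set h) (map set (flower h j F)))"
  proof (subst distinct_map, intro conjI inj_onI)
    show "distinct (map set (flower h j F))"
      using dist by (simp add: flower_def distinct_map_filter)
    fix C C' assume "C \<in> set (map set (flower h j F))" "C' \<in> set (map set (flower h j F))"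
      "C - set h = C' - set h"
    then show "C = C'" by (auto simp: flower_def)
  qed
  ultimately have "distinct (map set (petals h j F))" by simp
  moreover have "\<forall>c\<in>set (petals h j F). distinct c"
    using dist by (auto simp: petals_def flower_def)
  moreover have "clause_sets (petals h j F) \<inter> clause_sets F = {}"
  proof -
    have "C \<notin> clause_sets F" if C: "C \<in> petal_sets (clause_sets F) (set h) j" for C
    proof -
      obtain C' where "C' \<in> clause_sets F" "C \<subset> C'"
        using petal_setsD(2)[OF C] h by auto
      with F(2) show ?thesis unfolding antichain_def by blast
    qed
    then show ?thesis unfolding clause_sets_petals[OF dist(1)] by blast
  qed
  moreover have "admissible L S\<^sub>0 q (clause_sets (petals h j F @ F))"
    using dec by (simp add: decreases_def image_Un clause_sets_petals[OF dist(1)] Un_commute)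
  ultimately show ?thesis
    using dist by (auto simp: state_ok_def)
qed

text \<open>The candidate list contains only literals that occur in \<open>F\<close>. For the others
  the sunflower is empty, and \<open>0 < \<theta>\<close> closes the gap.\<close>

lemma light_singletons:
  assumes F: "state_ok L S\<^sub>0 q F" and "heavy \<theta> j (singletons F) F = []" "0 < \<theta>"
  shows "card (sunflower (clause_sets F) {l} j) < \<theta>"
proof (cases "\<exists>c\<in>set F. l \<in> set c")
  case True
  then have "[l] \<in> set (singletons F)" by (auto simp: singletons_def)
  then have "length (flower [l] j F) < \<theta>"
    using assms(2) by (auto simp: heavy_def filter_empty_conv not_le)
  then show ?thesis using length_flower[OF F, of "[l]" j] by simp
next
  case False
  then have "sunflower (clause_sets F) {l} j = {}" by (auto simp: sunflower_def)
  then show ?thesis using assms(3) by simp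
qed

lemma light_pairs:
  assumes F: "state_ok L S\<^sub>0 q F" and "heavy \<theta> j (pairs F) F = []" "0 < \<theta>" and h: "card h = 2"
  shows "card (sunflower (clause_sets F) h j) < \<theta>"
proof (cases "\<exists>c\<in>set F. h \<subseteq> set c")
  case True
  obtain a b where ab: "h = {a, b}" "a \<noteq> b" using h by (auto simp: card_2_iff)
  with True have "[a, b] \<in> set (pairs F)" by (auto simp: pairs_def)
  then have "length (flower [a, b] j F) < \<theta>"
    using assms(2) by (auto simp: heavy_def filter_empty_conv not_le)
  then show ?thesis using length_flower[OF F, of "[a, b]" j] ab by simp
next
  case False
  then have "sunflower (clause_sets F) h j = {}" by (auto simp: sunflower_def)
  then show ?thesis using assms(3) by simp
qed

lemma heavyD:
  assumes F: "state_ok L S\<^sub>0 q F" and ne: "heavy \<theta> j H F \<noteq> []"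
  shows "hd (heavy \<theta> j H F) \<in> set H"
    and "\<theta> \<le> card (sunflower (clause_sets F) (set (hd (heavy \<theta> j H F))) j)"
proof -
  have "hd (heavy \<theta> j H F) \<in> set (heavy \<theta> j H F)" using ne by simp
  then show "hd (heavy \<theta> j H F) \<in> set H"
    "\<theta> \<le> card (sunflower (clause_sets F) (set (hd (heavy \<theta> j H F))) j)"
    using length_flower[OF F] unfolding heavy_def by simp_all
qed

lemma find_heart_Some:
  assumes F: "state_ok L S\<^sub>0 q F" "antichain (clause_sets F)" and q: "0 < q"
    and h: "find_heart q F = Some (h, j)"
  defines "S \<equiv> clause_sets F"
  shows "state_ok L S\<^sub>0 q (h # F)"
    and "potential L S\<^sub>0 q (clause_sets (h # F)) + 1 \<le> potential L S\<^sub>0 q S"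
    and "state_ok L S\<^sub>0 q (petals h j F @ F)"
    and "potential L S\<^sub>0 q (clause_sets (petals h j F @ F)) + int (q * q) \<le> potential L S\<^sub>0 q S"
proof -
  have adm: "admissible L S\<^sub>0 q S" "antichain S"
    using F by (simp_all add: state_ok_def S_def)
  \<comment> \<open>In each case the facts \<open>light1\<close> and \<open>light2\<close>, the
    failures of the earlier tests, supply the degree bound for the family that is added.\<close>
  have key: "decreases L S\<^sub>0 q S 1 (S \<union> {set h}) \<and>
    decreases L S\<^sub>0 q S (q * q) (S \<union> petal_sets S (set h) j) \<and>
    distinct h \<and> h \<noteq> [] \<and> sunflower S (set h) j \<noteq> {} \<and> length h < j"
  proof (cases "heavy q 2 (singletons F) F = []")
    case False
    then have h_eq: "h = hd (heavy q 2 (singletons F) F)" "j = 2"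
      using h by (auto simp: find_heart_def)
    obtain l where l: "h = [l]"
      using heavyD(1)[OF F(1) False] h_eq by (auto simp: singletons_def)
    have card: "q \<le> card (sunflower S {l} 2)"
      using heavyD(2)[OF F(1) False, folded h_eq(1)] l by (simp add: S_def)
    then have "sunflower S {l} 2 \<noteq> {}" using q by auto
    then show ?thesis
      using decreases_unit_heart[OF adm q, of _ l 2] decreases_petal_units[OF adm, of "{l}" 2] card
      unfolding l h_eq(2) by auto
  next
    case True
    note light1 = light_singletons[OF F(1) this q, folded S_def]
    show ?thesis
    proof (cases "heavy q 3 (pairs F) F = []")
      case False
      then have h_eq: "h = hd (heavy q 3 (pairs F) F)" "j = 3"
        using h True by (auto simp: find_heart_def)
      obtain a b where ab: "h = [a, b]" "a \<noteq> b"
        using heavyD(1)[OF F(1) False] h_eq by (auto simp: pairs_def)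
      have card: "q \<le> card (sunflower S {a, b} 3)"
        using heavyD(2)[OF F(1) False, folded h_eq(1)] ab by (simp add: S_def)
      then have "sunflower S {a, b} 3 \<noteq> {}" using q by auto
      then show ?thesis
        using decreases_pair_heart[OF adm light1, of "{a, b}"] ab(2) card
          decreases_petal_units[OF adm, of "{a, b}" 3]
        unfolding ab(1) h_eq(2) by auto
    next
      case light2: True
      note light2 = light_pairs[OF F(1) this q, folded S_def]
      have ne: "heavy (q * q) 3 (singletons F) F \<noteq> []"
        and h_eq: "h = hd (heavy (q * q) 3 (singletons F) F)" "j = 3"
        using h True \<open>heavy q 3 (pairs F) F = []\<close> by (auto simp: find_heart_def split: if_splits)
      obtain l where l: "h = [l]"
        using heavyD(1)[OF F(1) ne] h_eq by (auto simp: singletons_def)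
      have card: "q * q \<le> card (sunflower S {l} 3)"
        using heavyD(2)[OF F(1) ne, folded h_eq(1)] l by (simp add: S_def)
      then have "sunflower S {l} 3 \<noteq> {}" using q by auto
      then show ?thesis
        using decreases_unit_heart[OF adm q, of _ l 3] decreases_petal_pairs[OF adm light1 light2 card]
        unfolding l h_eq(2) by auto
    qed
  qed
  then obtain c where c: "c \<in> sunflower S (set h) j" by blast
  show "state_ok L S\<^sub>0 q (h # F)"
    using key c by (intro state_ok_Cons[OF F, of h c j 1]) (simp_all add: S_def)
  show "state_ok L S\<^sub>0 q (petals h j F @ F)"
    using key by (intro state_ok_petals[OF F, of h j "q * q"]) (simp_all add: S_def)
  have "clause_sets (petals h j F @ F) = S \<union> petal_sets S (set h) j"
    using F(1) by (simp add: image_Un clause_sets_petals state_ok_def S_def Un_commute)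
  then show "potential L S\<^sub>0 q (clause_sets (petals h j F @ F)) + int (q * q) \<le> potential L S\<^sub>0 q S"
    using key by (simp add: decreases_def)
  show "potential L S\<^sub>0 q (clause_sets (h # F)) + 1 \<le> potential L S\<^sub>0 q S"
    using key by (simp add: decreases_def S_def)
qed

lemma find_heart_None:
  assumes F: "state_ok L S\<^sub>0 q F" and q: "0 < q" and h: "find_heart q F = None"
  shows "length F \<le> 1 + card L * (1 + q + q * q)"
proof -
  have none: "heavy q 2 (singletons F) F = []" "heavy (q * q) 3 (singletons F) F = []"
    using h by (auto simp: find_heart_def split: if_splits)
  have "length F = card (clause_sets F)"
    using F distinct_card[of "map set F"] by (simp add: state_ok_def)
  also have "\<dots> \<le> 1 + card L * (1 + q + q * q)"
  proof (rule card_sparse_family)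
    show "card (sunflower (clause_sets F) {l} 2) \<le> q" for l
      using light_singletons[OF F none(1) q] by (simp add: less_imp_le)
    show "card (sunflower (clause_sets F) {l} 3) \<le> q * q" for l
      using light_singletons[OF F none(2)] q by (simp add: less_imp_le)
    show "finite L" "\<And>c. c \<in> clause_sets F \<Longrightarrow> c \<subseteq> L \<and> card c \<le> 3"
      using F by (auto simp: state_ok_def admissible_def)
  qed
  finally show ?thesis .
qed

text \<open>Such a set consists of the entries of a triple over \<open>L\<close> extended by a blank
  \<open>None\<close>.\<close>

lemma card_subsets_le_3:
  assumes "finite L"
  shows "card {X. X \<subseteq> L \<and> card X \<le> 3} \<le> Suc (card L) ^ 3"
proof -
  let ?O = "insert None (Some ` L)"
  let ?f = "\<lambda>(a, b, c). {x. Some x \<in> {a, b, c}}"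
  have "X \<in> ?f ` (?O \<times> ?O \<times> ?O)" if "X \<subseteq> L" "card X \<le> 3" for X
  proof -
    have "finite X" using that assms finite_subset by blast
    then have "X = {} \<or> card X = 1 \<or> card X = 2 \<or> card X = 3"
      using that(2) card_0_eq[of X] by linarith
    then consider "X = {}" | a where "X = {a}" | a b where "X = {a, b}" | a b c where "X = {a, b, c}"
      unfolding card_1_singleton_iff One_nat_def card_2_iff card_3_iff by blast
    then show ?thesis
    proof cases
      case 1
      then show ?thesis by (intro image_eqI[of _ _ "(None, None, None)"]) auto
    next
      case 2
      then show ?thesis using that by (intro image_eqI[of _ _ "(Some a, None, None)"]) auto
    next
      case 3
      then show ?thesis using that by (intro image_eqI[of _ _ "(Some a, Some b, None)"]) auto
    next
      case 4
      then show ?thesis using that by (intro image_eqI[of _ _ "(Some a, Some b, Some c)"]) auto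
    qed
  qed
  then have "{X. X \<subseteq> L \<and> card X \<le> 3} \<subseteq> ?f ` (?O \<times> ?O \<times> ?O)" by blast
  then have "card {X. X \<subseteq> L \<and> card X \<le> 3} \<le> card (?f ` (?O \<times> ?O \<times> ?O))"
    using assms by (intro card_mono) auto
  also have "\<dots> \<le> card (?O \<times> ?O \<times> ?O)"
    using assms by (intro card_image_le) auto
  also have "\<dots> = card ?O ^ 3"
    by (simp only: card_cartesian_product power3_eq_cube mult.assoc)
  also have "card ?O = Suc (card L)"
    using assms by (subst card_insert_disjoint) (auto simp: card_image)
  finally show ?thesis .
qed

lemma leaves_enc_list_bound:
  assumes "\<And>x. x \<in> set xs \<Longrightarrow> leaves (e x) \<le> b"
  shows "leaves (enc_list e xs) \<le> length xs * b + 1"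
  using assms
proof (induction xs)
  case (Cons x xs)
  from Cons.prems have "leaves (e x) \<le> b" by simp
  moreover have "leaves (enc_list e xs) \<le> length xs * b + 1" using Cons by simp
  ultimately show ?case by simp
qed simp

text \<open>Bounds every formula met in the search by the number of literals alone, so the work per
  node is polynomial in the number of variables. A literal has 2 leaves and a list one more for its
  end, which gives 7 for a clause.\<close>

lemma state_ok_leaves:
  assumes "state_ok L S\<^sub>0 q F"
  shows "leaves (enc_cnf F) \<le> Suc (card L) ^ 3 * 7 + 1"
proof -
  have dist: "\<forall>c\<in>set F. distinct c" "distinct (map set F)" and L: "finite L"
    and sub: "\<And>c. c \<in> set F \<Longrightarrow> set c \<subseteq> L \<and> card (set c) \<le> 3"
    using assms by (simp_all add: state_ok_def admissible_def)
  have "leaves (enc_clause c) \<le> 7" if "c \<in> set F" for c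
  proof -
    have "leaves (enc_clause c) \<le> length c * 2 + 1"
      by (intro leaves_enc_list_bound) (simp add: enc_literal_eq)
    also have "length c \<le> 3" using sub[OF that] dist(1) that by (simp add: distinct_card)
    finally show ?thesis by simp
  qed
  then have "leaves (enc_cnf F) \<le> length F * 7 + 1"
    by (rule leaves_enc_list_bound)
  also have "length F = card (clause_sets F)"
    using distinct_card[OF dist(2)] by simp
  also have "card (clause_sets F) \<le> card {X. X \<subseteq> L \<and> card X \<le> 3}"
    using sub L by (intro card_mono) auto
  also have "\<dots> \<le> Suc (card L) ^ 3" using card_subsets_le_3[OF L] .
  finally show ?thesis by simp
qed

text \<open>With the input itself as \<open>S\<^sub>0\<close> there are no new pairs, so the degree
  bound holds trivially. \<open>L\<close> contains both literals of every occurring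
  variable.\<close>

lemma state_ok_initial:
  assumes "wf_3cnf F"
  defines "V \<equiv> \<Union>c\<in>set F. var ` set c"
  shows "state_ok (Pos ` V \<union> Neg ` V) (clause_sets F) q F"
    and "card (Pos ` V \<union> Neg ` V) \<le> 2 * num_vars F"
proof -
  have V: "finite V" by (simp add: V_def)
  have "card (Pos ` V \<union> Neg ` V) \<le> card (Pos ` V) + card (Neg ` V)" by (rule card_Un_le)
  also have "\<dots> \<le> card V + card V" by (intro add_mono card_image_le V)
  finally show "card (Pos ` V \<union> Neg ` V) \<le> 2 * num_vars F" by (simp add: num_vars_def V_def)
  have "set c \<subseteq> Pos ` V \<union> Neg ` V" if "c \<in> set F" for c
  proof
    fix l assume "l \<in> set c"
    with that have "var l \<in> V" by (auto simp: V_def)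
    then show "l \<in> Pos ` V \<union> Neg ` V" by (cases l) auto
  qed
  moreover have "card (set c) \<le> 3" if "c \<in> set F" for c
    using assms(1) that card_length[of c] by (auto simp: wf_3cnf_def)
  moreover have "new_pairs (clause_sets F) (clause_sets F) = {}"
    by (auto simp: new_pairs_def mins_def)
  ultimately show "state_ok (Pos ` V \<union> Neg ` V) (clause_sets F) q F"
    using assms(1) V by (auto simp: state_ok_def admissible_def wf_3cnf_def)
qed

section \<open>From sparse formulas to linear equations\<close>

definition literal_bit :: "(nat \<Rightarrow> bit) \<Rightarrow> literal \<Rightarrow> bit" where
  "literal_bit \<alpha> l = \<alpha> (var l) + (if positive l then 0 else 1)"

lemma satisfies_literal_bit:
  "satisfies_literal \<beta> l \<longleftrightarrow> literal_bit (\<lambda>v. of_bool (\<beta> v)) l = 1"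
  by (cases l) (auto simp: literal_bit_def)

lemma satisfies_equation_of:
  "satisfies_equation \<alpha> (equation_of w c) \<longleftrightarrow> (\<Sum>l\<leftarrow>c. literal_bit \<alpha> l) = 1"
proof -
  let ?neg = "\<lambda>l. if positive l then 0 else 1 :: bit"
  have step: "(\<lambda>b l. if positive l then b else b + 1) = (\<lambda>b l. b + ?neg l)"
    by (intro ext) simp
  have foldl_sum: "foldl (\<lambda>b l. b + f l) b c = b + (\<Sum>l\<leftarrow>c. f l)" for b :: bit and f
    by (induction c arbitrary: b) (simp_all only: foldl.simps list.map sum_list_simps add_0_right add.assoc)
  \<comment> \<open>In characteristic 2 the constant may change sides without a sign.\<close>
  have "(x = 1 + y) = (x + y = 1)" for x y :: bit
    by (cases x; cases y) auto
  then show ?thesis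
    unfolding equation_of_def satisfies_equation.simps literal_bit_def sum_list_addf step foldl_sum
    by (simp only: map_map o_def)
qed

text \<open>Twice the amount by which the satisfied weight exceeds the average \<open>W/2\<close>.
  The question of the problem becomes the integer inequality \<open>k <= excess\<close>.\<close>

definition excess :: "(nat \<Rightarrow> bit) \<Rightarrow> equation list \<Rightarrow> int" where
  "excess \<alpha> E = (\<Sum>e\<leftarrow>E. if satisfies_equation \<alpha> e then int (weight e) else - int (weight e))"

lemma excess_append: "excess \<alpha> (E @ E') = excess \<alpha> E + excess \<alpha> E'"
  by (simp add: excess_def)

lemma excess_eq: "excess \<alpha> E = 2 * int (satisfied_weight \<alpha> E) - int (total_weight E)"
  by (induction E) (auto simp: excess_def satisfied_weight_def total_weight_def)

lemma is_yes_excess: "is_yes max3lin2_aa (k, E) \<longleftrightarrow> (\<exists>\<alpha>. int k \<le> excess \<alpha> E)"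
proof -
  have "real t / 2 + real k / 2 \<le> real s \<longleftrightarrow> int k \<le> 2 * int s - int t" for s t
    by linarith
  then show ?thesis
    unfolding excess_eq by (simp add: max3lin2_aa_def)
qed

lemma equations_Cons:
  "singletons (c # G) = singletons [c] @ singletons G" "pairs (c # G) = pairs [c] @ pairs G"
  "filter P (c # G) = filter P [c] @ filter P G"
  by (simp_all add: singletons_def pairs_def)

text \<open>Equations are grouped by kind, so those of \<open>c\<close> are scattered over the list.
  The excess does not depend on their order.\<close>

lemma excess_equations_Cons:
  "excess \<alpha> (equations (c # G)) = excess \<alpha> (equations [c]) + excess \<alpha> (equations G)"
  unfolding equations_def excess_append map_append
    equations_Cons(1,2)[of c G] equations_Cons(3)[of _ c G] by simp

lemma length_equations_Cons:
  "length (equations (c # G)) = length (equations [c]) + length (equations G)"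
  unfolding equations_def length_append map_append
    equations_Cons(1,2)[of c G] equations_Cons(3)[of _ c G] by simp

lemma short_list_cases:
  assumes "length c \<le> 3"
  obtains "c = []" | a where "c = [a]" | a b where "c = [a, b]" | a b d where "c = [a, b, d]"
proof -
  from assms consider "length c = 0" | "length c = 1" | "length c = 2" | "length c = 3"
    by linarith
  then show ?thesis
    using that by cases (auto simp: length_Suc_conv numeral_2_eq_2 numeral_3_eq_3)
qed

lemma excess_Nil: "excess \<alpha> [] = 0"
  by (simp add: excess_def)

lemma excess_equation_of_Cons:
  "excess \<alpha> (equation_of w c # E)
    = (if (\<Sum>l\<leftarrow>c. literal_bit \<alpha> l) = 1 then int w else - int w) + excess \<alpha> E"
proof -
  have "weight (equation_of w c) = w" by (simp add: equation_of_def)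
  then show ?thesis by (simp only: excess_def satisfies_equation_of list.map sum_list_simps)
qed

text \<open>Of the \<open>2 ^ s - 1\<close> nonempty sums of \<open>s\<close> bits, exactly \<open>2 ^ (s - 1)\<close> equal 1 unless all bits
  are 0. Every sum is counted with weight 2, a sum of two bits once in either order.\<close>

lemma excess_clause:
  assumes "distinct c" "length c \<le> 3"
  shows "if \<exists>l\<in>set c. literal_bit \<alpha> l = 1 then excess \<alpha> (equations [c]) = 2
     else excess \<alpha> (equations [c]) \<le> 0"
proof -
  have bit: "literal_bit \<alpha> l = 0 \<or> literal_bit \<alpha> l = 1" for l
    by (cases "literal_bit \<alpha> l") auto
  from assms(2) show ?thesis
  proof (cases rule: short_list_cases)
    \<comment> \<open>The empty clause yields no equation and has excess 0; for this reason the
      falsified case claims only a bound by 0.\<close>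
    case 1
    then show ?thesis by (simp add: equations_def singletons_def pairs_def excess_Nil)
  next
    case (2 a)
    then show ?thesis using bit[of a]
      by (auto simp: equations_def singletons_def pairs_def excess_Nil excess_equation_of_Cons)
  next
    case (3 a b)
    then have "a \<noteq> b" "b \<noteq> a" using assms(1) by auto
    with 3 show ?thesis using bit[of a] bit[of b]
      by (elim disjE)
        (simp_all add: equations_def singletons_def pairs_def excess_Nil excess_equation_of_Cons)
  next
    case (4 a b d)
    then have "a \<noteq> b" "b \<noteq> a" "a \<noteq> d" "d \<noteq> a" "b \<noteq> d" "d \<noteq> b" using assms(1) by auto
    with 4 show ?thesis using bit[of a] bit[of b] bit[of d]
      by (elim disjE)
        (simp_all add: equations_def singletons_def pairs_def excess_Nil excess_equation_of_Cons)
  qed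
qed

text \<open>A clause of length 3 gives 3 single literals, 6 ordered pairs and itself.\<close>

lemma length_equations_clause:
  assumes "distinct c" "length c \<le> 3" shows "length (equations [c]) \<le> 10"
  using assms(2)
  by (cases rule: short_list_cases) (use assms(1) in \<open>simp_all add: equations_def singletons_def pairs_def\<close>)

lemma length_equations:
  assumes "\<forall>c\<in>set G. distinct c \<and> length c \<le> 3"
  shows "length (equations G) \<le> 10 * length G"
  using assms
proof (induction G)
  case (Cons c G)
  then show ?case
    using length_equations_clause[of c] length_equations_Cons[of c G] by simp
qed (simp add: equations_def singletons_def pairs_def)

text \<open>No clause contributes more than 2, so the total \<open>2 * length G\<close> is reached
  only if every clause contributes exactly 2. The upper bound is part of the claim because it is
  needed for the remaining clauses when the first one fails.\<close>

lemma excess_equations: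
  assumes "\<forall>c\<in>set G. distinct c \<and> length c \<le> 3"
  shows "excess \<alpha> (equations G) \<le> 2 * int (length G)
     \<and> (2 * int (length G) \<le> excess \<alpha> (equations G)
          \<longleftrightarrow> (\<forall>c\<in>set G. \<exists>l\<in>set c. literal_bit \<alpha> l = 1))"
  using assms
proof (induction G)
  case Nil
  then show ?case by (simp add: equations_def singletons_def pairs_def excess_Nil)
next
  case (Cons c G)
  then have IH: "excess \<alpha> (equations G) \<le> 2 * int (length G)"
    "2 * int (length G) \<le> excess \<alpha> (equations G)
      \<longleftrightarrow> (\<forall>c\<in>set G. \<exists>l\<in>set c. literal_bit \<alpha> l = 1)"
    by simp_all
  show ?case
  proof (cases "\<exists>l\<in>set c. literal_bit \<alpha> l = 1")
    case True
    then have "excess \<alpha> (equations (c # G)) = 2 + excess \<alpha> (equations G)"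
      using excess_clause[of c \<alpha>] Cons.prems excess_equations_Cons[of \<alpha> c G] by simp
    with True IH show ?thesis by auto
  next
    case False
    then have "excess \<alpha> (equations (c # G)) \<le> excess \<alpha> (equations G)"
      using excess_clause[of c \<alpha>] Cons.prems excess_equations_Cons[of \<alpha> c G] by simp
    with False IH(1) show ?thesis by auto
  qed
qed

lemma satisfiable_bits:
  "satisfiable F \<longleftrightarrow> (\<exists>\<alpha>. \<forall>c\<in>set F. \<exists>l\<in>set c. literal_bit \<alpha> l = 1)"
proof
  assume "satisfiable F"
  then show "\<exists>\<alpha>. \<forall>c\<in>set F. \<exists>l\<in>set c. literal_bit \<alpha> l = 1"
    unfolding satisfiable_def satisfies_literal_bit by blast
next
  assume "\<exists>\<alpha>. \<forall>c\<in>set F. \<exists>l\<in>set c. literal_bit \<alpha> l = 1"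
  then obtain \<alpha> where \<alpha>: "\<forall>c\<in>set F. \<exists>l\<in>set c. literal_bit \<alpha> l = 1" by blast
  have "(\<lambda>v. of_bool (\<alpha> v = 1)) = \<alpha>"
  proof
    fix v show "of_bool (\<alpha> v = 1) = \<alpha> v" by (cases "\<alpha> v") auto
  qed
  with \<alpha> have "\<forall>c\<in>set F. \<exists>l\<in>set c. satisfies_literal (\<lambda>v. \<alpha> v = 1) l"
    unfolding satisfies_literal_bit by simp
  then show "satisfiable F" unfolding satisfiable_def by blast
qed

lemma satisfiable_nontautological:
  "satisfiable (filter nontautological F) \<longleftrightarrow> satisfiable F"
proof -
  have "\<exists>l\<in>set c. satisfies_literal \<alpha> l" if taut: "\<not> nontautological c" for c \<alpha>
  proof -
    obtain l l' where l: "l \<in> set c" "l' \<in> set c" "var l = var l'" "l \<noteq> l'"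
      using taut by (auto simp: nontautological_def)
    have "var l = var l' \<Longrightarrow> l \<noteq> l' \<Longrightarrow> satisfies_literal \<alpha> l \<or> satisfies_literal \<alpha> l'"
      by (cases l; cases l') auto
    with l show ?thesis by blast
  qed
  then have "(\<forall>c\<in>set (filter nontautological F). \<exists>l\<in>set c. satisfies_literal \<alpha> l)
     \<longleftrightarrow> (\<forall>c\<in>set F. \<exists>l\<in>set c. satisfies_literal \<alpha> l)" for \<alpha>
    by auto
  then show ?thesis unfolding satisfiable_def by simp
qed

lemma wf_equations:
  assumes "\<forall>c\<in>set G. distinct c \<and> length c \<le> 3 \<and> nontautological c"
  shows "\<forall>e\<in>set (equations G). wf_equation e"
proof -
  have inj: "inj_on var (set c)" if "c \<in> set G" for c
    using assms that by (auto simp: nontautological_def inj_on_def)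
  have "wf_equation (equation_of w c)" if "distinct (map var c)" "length c \<le> 3" "0 < w" for w c
    using that by (simp add: equation_of_def)
  moreover have "distinct (map var c) \<and> length c \<le> 3"
    if "c \<in> set (singletons G) \<union> set (pairs G) \<union> set G" for c
    using that
  proof (elim UnE)
    assume "c \<in> set (pairs G)"
    then obtain c' a b where "c' \<in> set G" "a \<in> set c'" "b \<in> set c'" "a \<noteq> b" "c = [a, b]"
      by (auto simp: pairs_def)
    with inj[of c'] show ?thesis by (simp add: inj_on_eq_iff)
  next
    assume "c \<in> set G"
    then show ?thesis using inj assms by (simp add: distinct_map)
  qed (auto simp: singletons_def)
  ultimately show ?thesis by (auto simp: equations_def)
qed

lemma lin_instance_correct:
  assumes "\<forall>c\<in>set F. distinct c \<and> length c \<le> 3"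
  shows "lin_instance F \<in> instances max3lin2_aa"
    and "is_yes max3lin2_aa (lin_instance F) \<longleftrightarrow> satisfiable F"
    and "fst (lin_instance F) \<le> 2 * length F"
    and "length (snd (lin_instance F)) \<le> 10 * length F"
proof -
  let ?G = "filter nontautological F"
  have lin: "lin_instance F = (length (?G @ ?G), equations ?G)"
    by (simp only: lin_instance_def Let_def)
  have G: "\<forall>c\<in>set ?G. distinct c \<and> length c \<le> 3" using assms by simp
  have len: "length ?G \<le> length F" by (rule length_filter_le)
  show "lin_instance F \<in> instances max3lin2_aa"
    using wf_equations[of ?G] assms unfolding lin by (simp add: max3lin2_aa_def)
  have "int (length (?G @ ?G)) = 2 * int (length ?G)" by (simp only: length_append of_nat_add)
  moreover have "2 * int (length ?G) \<le> excess \<alpha> (equations ?G)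
      \<longleftrightarrow> (\<forall>c\<in>set ?G. \<exists>l\<in>set c. literal_bit \<alpha> l = 1)" for \<alpha>
    using excess_equations[OF G] by (rule conjunct2)
  ultimately have "is_yes max3lin2_aa (lin_instance F) \<longleftrightarrow> satisfiable ?G"
    unfolding lin is_yes_excess satisfiable_bits by (simp only:)
  then show "is_yes max3lin2_aa (lin_instance F) \<longleftrightarrow> satisfiable F"
    by (simp add: satisfiable_nontautological)
  show "fst (lin_instance F) \<le> 2 * length F" unfolding lin fst_conv length_append using len by linarith
  show "length (snd (lin_instance F)) \<le> 10 * length F"
    using length_equations[OF G] len unfolding lin snd_conv by linarith
qed

section \<open>The search program\<close>

text \<open>A nonnegative real quantity that falls by 1 per round allows at most its floor many
  rounds. It is real because the weights of search states are powers with real exponents.\<close>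

lemma runs_While_potential:
  fixes I :: "state \<Rightarrow> real \<Rightarrow> bool"
  assumes nonneg: "\<And>s p. I s p \<Longrightarrow> 0 \<le> p"
    and step: "\<And>s p. I s p \<Longrightarrow> s x \<noteq> Num 0 \<Longrightarrow> runs c s B (\<lambda>r. \<exists>p'. I r p' \<and> p' + 1 \<le> p)"
    and "I s p"
  shows "runs (CWhile x c) s (nat \<lfloor>p\<rfloor> * Suc B + 1) (\<lambda>r. r x = Num 0 \<and> (\<exists>p'. I r p'))"
  using \<open>I s p\<close>
proof (induction "nat \<lfloor>p\<rfloor>" arbitrary: s p rule: less_induct)
  case less
  let ?Q = "\<lambda>r. r x = Num 0 \<and> (\<exists>p'. I r p')"
  show ?case
  proof (cases "s x = Num 0")
    case True
    with less.prems have "?Q s" by blast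
    with True have "runs (CWhile x c) s 1 ?Q" by (rule runs_While_False)
    then show ?thesis by (rule runs_weaken) simp_all
  next
    case False
    note body = step[OF less.prems False]
    then obtain r0 p0 where "I r0 p0" "p0 + 1 \<le> p" unfolding runs_def by blast
    \<comment> \<open>The quantity is still nonnegative after the round, so it was at least 1 before
      and its floor is a successor.\<close>
    with nonneg[of r0 p0] have "1 \<le> p" by simp
    then obtain n where n: "nat \<lfloor>p\<rfloor> = Suc n" by (cases "nat \<lfloor>p\<rfloor>") simp_all
    have "runs c s B (\<lambda>r. runs (CWhile x c) r (n * Suc B + 1) ?Q)"
    proof (rule runs_weaken[OF body order.refl])
      fix r assume "\<exists>p'. I r p' \<and> p' + 1 \<le> p"
      then obtain p' where p': "I r p'" "p' + 1 \<le> p" by blast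
      have le: "nat \<lfloor>p'\<rfloor> \<le> n"
        using p'(2) nonneg[OF p'(1)] n by linarith
      have "runs (CWhile x c) r (nat \<lfloor>p'\<rfloor> * Suc B + 1) ?Q"
        by (rule less.hyps[OF _ p'(1)]) (use le n in simp)
      then show "runs (CWhile x c) r (n * Suc B + 1) ?Q"
        by (rule runs_weaken) (use le in \<open>simp_all only: add_le_mono1 mult_le_mono1\<close>)
    qed
    from runs_While_True[OF False this] show ?thesis
      by (rule runs_weaken) (simp_all add: n)
  qed
qed

text \<open>Resets the variables from 1 to \<open>n\<close>. The language has no empty command;
  \<open>CCopy 0 0\<close> takes its place.\<close>

fun clear :: "nat \<Rightarrow> com" where
  "clear 0 = CCopy 0 0"
| "clear (Suc n) = CSeq (clear n) (CConst (Suc n) 0)"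

lemma runs_clear:
  "runs (clear n) s (Suc n) (\<lambda>r. \<forall>x. r x = (if 0 < x \<and> x \<le> n then Num 0 else s x))"
proof (induction n)
  case 0
  show ?case unfolding clear.simps runs_basic by simp
next
  case (Suc n)
  have "runs (clear (Suc n)) s (Suc n + Suc 0) (\<lambda>r. \<forall>x. r x = (if 0 < x \<and> x \<le> Suc n then Num 0 else s x))"
    unfolding clear.simps
    by (rule runs_Seq, rule runs_weaken[OF Suc order.refl], subst runs_basic) auto
  then show ?case by simp
qed

definition search_body :: "nat \<Rightarrow> com \<Rightarrow> com \<Rightarrow> com" where
  "search_body M c P =
     CSeq (CLeft 0 (M+1)) (CSeq (CRight (M+1) (M+1)) (CSeq c (CSeq (CLeft (M+3) 0) (CSeq (CRight 0 0)
       (CIf (M+3)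
         (CSeq (CLeft (M+3) 0) (CSeq (CRight 0 0) (CSeq (CNode (M+1) 0 (M+1)) (CNode (M+1) (M+3) (M+1)))))
         (CSeq (clear M) (CSeq P (CIf 0 (CConst (M+2) 1) (CConst (M+3) 0)))))))))"

text \<open>An upper bound on the number of nodes of the search tree below \<open>F\<close>.\<close>

definition state_weight :: "literal set \<Rightarrow> literal set set \<Rightarrow> nat \<Rightarrow> real \<Rightarrow> clause list \<Rightarrow> real" where
  "state_weight L S\<^sub>0 q \<eta> F = 2 * 2 powr (\<eta> * potential L S\<^sub>0 q (clause_sets F)) - 1"

lemma state_weight_ge_1:
  assumes "state_ok L S\<^sub>0 q F" "0 < \<eta>" shows "1 \<le> state_weight L S\<^sub>0 q \<eta> F"
proof -
  have "0 \<le> potential L S\<^sub>0 q (clause_sets F)"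
    using assms(1) by (intro potential_nonneg) (simp add: state_ok_def)
  then have "0 \<le> \<eta> * potential L S\<^sub>0 q (clause_sets F)" using assms(2) by simp
  then have "2 powr 0 \<le> (2::real) powr (\<eta> * potential L S\<^sub>0 q (clause_sets F))"
    by (intro powr_mono) auto
  then show ?thesis by (simp add: state_weight_def)
qed

text \<open>By the choice of \<open>\<eta>\<close> the powers \<open>x1\<close>, \<open>x2\<close>
  of the children and \<open>x\<close> of the parent satisfy \<open>x1 + x2 <= x\<close>. Hence
  \<open>(2 * x1 - 1) + (2 * x2 - 1) + 1 <= 2 * x - 1\<close>, where the summand 1 is the node
  itself.\<close>

lemma state_weight_branch:
  assumes "0 < \<eta>" and \<eta>: "2 powr (- \<eta>) + 2 powr (- \<eta> * (real q * real q)) \<le> (1::real)"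
    and "potential L S\<^sub>0 q (clause_sets F1) + 1 \<le> potential L S\<^sub>0 q (clause_sets F)"
    and "potential L S\<^sub>0 q (clause_sets F2) + int (q * q) \<le> potential L S\<^sub>0 q (clause_sets F)"
  shows "state_weight L S\<^sub>0 q \<eta> F1 + state_weight L S\<^sub>0 q \<eta> F2 + 1 \<le> state_weight L S\<^sub>0 q \<eta> F"
proof -
  let ?p = "\<lambda>F. real_of_int (potential L S\<^sub>0 q (clause_sets F))"
  have "?p F1 + 1 \<le> ?p F" using assms(3) by linarith
  then have "\<eta> * (?p F1 + 1) \<le> \<eta> * ?p F" using assms(1) by (intro mult_left_mono) auto
  then have "2 powr (\<eta> * ?p F1) \<le> 2 powr (\<eta> * ?p F + - \<eta>)"
    by (intro powr_mono) (auto simp: algebra_simps)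
  moreover have "?p F2 + real (q * q) \<le> ?p F" using assms(4) by linarith
  then have "\<eta> * (?p F2 + real (q * q)) \<le> \<eta> * ?p F" using assms(1) by (intro mult_left_mono) auto
  then have "2 powr (\<eta> * ?p F2) \<le> 2 powr (\<eta> * ?p F + - \<eta> * (real q * real q))"
    by (intro powr_mono) (auto simp: algebra_simps)
  ultimately have "2 powr (\<eta> * ?p F1) + 2 powr (\<eta> * ?p F2)
      \<le> 2 powr (\<eta> * ?p F) * (2 powr (- \<eta>) + 2 powr (- \<eta> * (real q * real q)))"
    unfolding powr_add distrib_left by linarith
  also have "\<dots> \<le> 2 powr (\<eta> * ?p F) * 1" using \<eta> by (intro mult_left_mono) auto
  finally show ?thesis by (simp add: state_weight_def)
qed

text \<open>Here \<open>a\<close> is the fixed answer for the input formula, and \<open>p\<close>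
  bounds the number of nodes still to be visited.\<close>

definition search_invariant ::
  "nat \<Rightarrow> literal set \<Rightarrow> literal set set \<Rightarrow> nat \<Rightarrow> real \<Rightarrow> bool \<Rightarrow> state \<Rightarrow> real \<Rightarrow> bool" where
  "search_invariant M L S\<^sub>0 q \<eta> a s p \<longleftrightarrow>
     (\<exists>Fs. s (M+1) = enc_list enc_cnf Fs \<and> (\<forall>F\<in>set Fs. state_ok L S\<^sub>0 q F)
        \<and> p = (\<Sum>F\<leftarrow>Fs. state_weight L S\<^sub>0 q \<eta> F)
        \<and> (a \<longleftrightarrow> s (M+2) \<noteq> Num 0 \<or> (\<exists>F\<in>set Fs. satisfiable F)))"

lemma search_invariant_nonneg:
  assumes "0 < \<eta>" "search_invariant M L S\<^sub>0 q \<eta> a s p" shows "0 \<le> p"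
proof -
  have "0 \<le> state_weight L S\<^sub>0 q \<eta> F" if "state_ok L S\<^sub>0 q F" for F
    using state_weight_ge_1[OF that assms(1)] by linarith
  then show ?thesis
    using assms(2) by (auto simp: search_invariant_def intro!: sum_list_nonneg)
qed

lemma runs_search_body:
  assumes c: "\<And>s F. state_ok L S\<^sub>0 q F \<Longrightarrow> s 0 = enc_cnf F \<Longrightarrow>
      runs c s TE (\<lambda>s'. s' 0 = expand q (reduce F))"
    and P: "\<And>F. state_ok L S\<^sub>0 q F \<Longrightarrow> find_heart q F = None \<Longrightarrow>
      runs P (initial (encode max3lin2_aa (lin_instance F))) TP (\<lambda>s'. s' 0 \<noteq> Num 0 \<longleftrightarrow> satisfiable F)"
    and M: "var_bound c \<le> M" "var_bound P \<le> M"
    and q: "0 < q" and \<eta>: "0 < \<eta>" "2 powr (- \<eta>) + 2 powr (- \<eta> * (real q * real q)) \<le> (1::real)"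
    and inv: "search_invariant M L S\<^sub>0 q \<eta> a s p" and ne: "s (M+1) \<noteq> Num 0"
  shows "runs (search_body M c P) s (TE + M + TP + 12)
    (\<lambda>r. \<exists>p'. search_invariant M L S\<^sub>0 q \<eta> a r p' \<and> p' + 1 \<le> p)"
proof -
  obtain Fs where Fs: "s (M+1) = enc_list enc_cnf Fs" "\<forall>F\<in>set Fs. state_ok L S\<^sub>0 q F"
    "p = (\<Sum>F\<leftarrow>Fs. state_weight L S\<^sub>0 q \<eta> F)"
    "a \<longleftrightarrow> s (M+2) \<noteq> Num 0 \<or> (\<exists>F\<in>set Fs. satisfiable F)"
    using inv unfolding search_invariant_def by blast
  from ne Fs(1) obtain F Gs where Fs_eq: "Fs = F # Gs" by (cases Fs) auto
  let ?R = "reduce F"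
  let ?Q = "\<lambda>r. \<exists>p'. search_invariant M L S\<^sub>0 q \<eta> a r p' \<and> p' + 1 \<le> p"
  have F: "state_ok L S\<^sub>0 q F" using Fs(2) Fs_eq by simp
  have R: "state_ok L S\<^sub>0 q ?R" "antichain (clause_sets ?R)"
    using state_ok_reduce[OF F] by (simp_all add: clause_sets_reduce antichain_mins)
  \<comment> \<open>The potential looks only at minimal clauses, so \<open>reduce\<close> leaves it
    unchanged.\<close>
  have weight_R: "state_weight L S\<^sub>0 q \<eta> ?R = state_weight L S\<^sub>0 q \<eta> F"
    by (simp add: state_weight_def clause_sets_reduce potential_mins)
  have sat_R: "satisfiable ?R \<longleftrightarrow> satisfiable F" by (rule satisfiable_reduce)
  let ?branch = "CSeq (CLeft (M+3) 0) (CSeq (CRight 0 0) (CSeq (CNode (M+1) 0 (M+1)) (CNode (M+1) (M+3) (M+1))))"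
  let ?leaf = "CSeq (clear M) (CSeq P (CIf 0 (CConst (M+2) 1) (CConst (M+3) 0)))"
  \<comment> \<open>One bound for both alternatives: the leaf takes at most
    \<open>Suc M + (TP + 2)\<close> steps, the branching 4.\<close>
  let ?T = "Suc M + (TP + Suc (Suc 0)) + 4"
  have branch: "runs ?branch s' ?T ?Q"
    if h: "find_heart q ?R = Some (h, j)"
      and s': "s' 0 = Node (enc_cnf (h # ?R)) (enc_cnf (petals h j ?R @ ?R))"
        "s' (M+1) = enc_list enc_cnf Gs" "s' (M+2) = s (M+2)" for s' h j
  proof -
    note children = find_heart_Some[OF R q h]
    let ?r = "s'(M+3 := left (s' 0), 0 := right (s' 0), M+1 := Node (right (s' 0)) (s' (M+1)),
      M+1 := Node (left (s' 0)) (Node (right (s' 0)) (s' (M+1))))"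
    have "search_invariant M L S\<^sub>0 q \<eta> a ?r
        (\<Sum>F\<leftarrow>(h # ?R) # (petals h j ?R @ ?R) # Gs. state_weight L S\<^sub>0 q \<eta> F)"
      unfolding search_invariant_def
      by (rule exI[of _ "(h # ?R) # (petals h j ?R @ ?R) # Gs"])
        (use s' Fs Fs_eq children sat_R satisfiable_branch[of ?R h j] in auto)
    moreover have "(\<Sum>F\<leftarrow>(h # ?R) # (petals h j ?R @ ?R) # Gs. state_weight L S\<^sub>0 q \<eta> F) + 1 \<le> p"
      using state_weight_branch[OF \<eta> children(2,4)] weight_R Fs(3) Fs_eq by simp
    ultimately have "?Q ?r" by blast
    have "runs ?branch s' (Suc (Suc (Suc (Suc 0)))) ?Q"
      apply (rule runs_Seq_basic)+
      apply (subst runs_basic)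
      using \<open>?Q ?r\<close> by simp
    then show ?thesis by (rule runs_weaken) auto
  qed
  have leaf: "runs ?leaf s' ?T ?Q"
    if h: "find_heart q ?R = None"
      and s': "s' 0 = encode max3lin2_aa (lin_instance ?R)"
        "s' (M+1) = enc_list enc_cnf Gs" "s' (M+2) = s (M+2)" for s'
  proof -
    obtain t r0 where P_run: "exec P (initial (encode max3lin2_aa (lin_instance ?R))) t r0" "t \<le> TP"
      "r0 0 \<noteq> Num 0 \<longleftrightarrow> satisfiable ?R"
      using P[OF R(1) h] by (auto simp: runs_def)
    let ?I = "\<lambda>r. r (M+1) = enc_list enc_cnf Gs \<and> (a \<longleftrightarrow> r (M+2) \<noteq> Num 0 \<or> (\<exists>F\<in>set Gs. satisfiable F))"
    \<comment> \<open>The removed formula had weight at least 1, which is the required drop.\<close>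
    have I: "?Q r" if "?I r" for r
    proof -
      have "search_invariant M L S\<^sub>0 q \<eta> a r (\<Sum>F\<leftarrow>Gs. state_weight L S\<^sub>0 q \<eta> F)"
        unfolding search_invariant_def by (rule exI[of _ Gs]) (use that Fs(2) Fs_eq in auto)
      moreover have "(\<Sum>F\<leftarrow>Gs. state_weight L S\<^sub>0 q \<eta> F) + 1 \<le> p"
        using state_weight_ge_1[OF F \<eta>(1)] Fs(3) Fs_eq by simp
      ultimately show ?thesis by blast
    qed
    \<comment> \<open>After clearing, variables 0 to \<open>M\<close> agree with the initial state.
      \<open>P\<close> touches no others, so its run carries over and leaves the stack and the
      answer intact.\<close>
    have solve: "runs P r TP (\<lambda>r'. (r' 0 \<noteq> Num 0 \<longleftrightarrow> satisfiable ?R) \<and> (\<forall>x>M. r' x = r x))"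
      if r: "\<forall>x. r x = (if 0 < x \<and> x \<le> M then Num 0 else s' x)" for r
    proof -
      have "r x = initial (encode max3lin2_aa (lin_instance ?R)) x" if "x < Suc M" for x
        using r s'(1) that by (auto simp: initial_def)
      then obtain r' where r': "exec P r t r'" "\<forall>x<Suc M. r' x = r0 x"
        using exec_agree[OF P_run(1), of "Suc M" r] M(2) by auto
      have "r' x = r x" if "x > M" for x
        using exec_frame[OF r'(1), of x] M(2) that by simp
      then show ?thesis
        unfolding runs_def using r' P_run(2,3) by (intro exI[of _ t] exI[of _ r']) auto
    qed
    have "runs ?leaf s' (Suc M + (TP + Suc (Suc 0))) ?Q"
    proof (rule runs_Seq, rule runs_weaken[OF runs_clear order.refl])
      fix r assume r: "\<forall>x. r x = (if 0 < x \<and> x \<le> M then Num 0 else s' x)"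
      show "runs (CSeq P (CIf 0 (CConst (M+2) 1) (CConst (M+3) 0))) r (TP + Suc (Suc 0)) ?Q"
      proof (rule runs_Seq, rule runs_weaken[OF solve[OF r] order.refl])
        fix r' assume r': "(r' 0 \<noteq> Num 0 \<longleftrightarrow> satisfiable ?R) \<and> (\<forall>x>M. r' x = r x)"
        have r'_eq: "r' (M+1) = enc_list enc_cnf Gs" "r' (M+2) = s (M+2)"
          using r' r s' by simp_all
        show "runs (CIf 0 (CConst (M+2) 1) (CConst (M+3) 0)) r' (Suc (Suc 0)) ?Q"
        proof (rule runs_If)
          assume "r' 0 \<noteq> Num 0"
          then have "satisfiable F" using r' sat_R by simp
          then show "runs (CConst (M+2) 1) r' (Suc 0) ?Q"
            unfolding runs_basic by (intro I) (use r'_eq Fs(4) Fs_eq in simp)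
        next
          assume "r' 0 = Num 0"
          then have "\<not> satisfiable F" using r' sat_R by simp
          then show "runs (CConst (M+3) 0) r' (Suc 0) ?Q"
            unfolding runs_basic by (intro I) (use r'_eq Fs(4) Fs_eq in simp)
        qed
      qed
    qed
    then show ?thesis by (rule runs_weaken) auto
  qed
  have stack: "s (Suc M) = Node (enc_cnf F) (enc_list enc_cnf Gs)"
    using Fs(1) Fs_eq by simp
  have "runs (search_body M c P) s (Suc (Suc (TE + Suc (Suc (Suc ?T))))) ?Q"
    unfolding search_body_def
  proof (rule runs_Seq_basic, rule runs_Seq_basic, rule runs_Seq_frame)
    let ?s = "s(0 := left (s (M+1)), M+1 := right ((s(0 := left (s (M+1)))) (M+1)))"
    show "runs c ?s TE (\<lambda>s'. s' 0 = expand q ?R)"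
      by (rule c[OF F]) (simp add: stack)
    fix r assume r: "r 0 = expand q ?R" "\<And>x. var_bound c \<le> x \<Longrightarrow> r x = ?s x"
    have r_eq: "r (M+1) = enc_list enc_cnf Gs" "r (M+2) = s (M+2)"
      using r(2)[of "M+1"] r(2)[of "M+2"] M(1) by (simp_all add: stack)
    show "runs (CSeq (CLeft (M+3) 0) (CSeq (CRight 0 0) (CIf (M+3) ?branch ?leaf))) r
      (Suc (Suc (Suc ?T))) ?Q"
    proof (rule runs_Seq_basic, rule runs_Seq_basic, rule runs_If)
      let ?r = "r(M+3 := left (r 0), 0 := right ((r(M+3 := left (r 0))) 0))"
      {
        assume "?r (M+3) \<noteq> Num 0"
        then obtain h j where h: "find_heart q ?R = Some (h, j)"
          by (cases "find_heart q ?R") (auto simp: r(1) expand_def)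
        then show "runs ?branch ?r ?T ?Q"
          by (rule branch) (simp_all add: r(1) expand_def h r_eq[simplified])
      next
        assume "?r (M+3) = Num 0"
        then have h: "find_heart q ?R = None"
          by (auto simp: r(1) expand_def split: option.splits)
        then show "runs ?leaf ?r ?T ?Q"
          by (rule leaf) (simp_all add: r(1) expand_def h r_eq[simplified])
      }
    qed
  qed
  then show ?thesis by (rule runs_weaken) auto
qed

section \<open>The total running time\<close>

lemma power_le_powr:
  fixes \<gamma> :: real
  assumes "0 < \<gamma>"
  shows "\<exists>C. \<forall>n::nat. (2 * real n + 1) ^ k \<le> C * 2 powr (\<gamma> * real n)"
proof -
  \<comment> \<open>Each of the \<open>k\<close> factors gets an equal share of the exponent;
    \<open>Suc k\<close> avoids division by 0.\<close>
  define \<theta> where "\<theta> = \<gamma> / Suc k"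
  have \<theta>: "0 < \<theta>" "\<theta> * k \<le> \<gamma>"
    using assms by (simp_all add: \<theta>_def field_simps)
  define C where "C = max 1 (2 / (\<theta> * ln 2))"
  have C: "1 \<le> C" "2 \<le> C * (\<theta> * ln 2)"
  proof -
    have "2 / (\<theta> * ln 2) \<le> C" by (simp add: C_def)
    then show "2 \<le> C * (\<theta> * ln 2)" using \<theta>(1) by (simp add: field_simps)
  qed (simp add: C_def)
  \<comment> \<open>The linear growth is absorbed by \<open>1 + x <= exp x\<close>, with
    \<open>C\<close> covering both the constant term and the slope.\<close>
  have base: "2 * real n + 1 \<le> C * 2 powr (\<theta> * real n)" for n
  proof -
    have "2 * real n \<le> C * (\<theta> * ln 2) * real n" using C(2) by (intro mult_right_mono) auto
    then have "2 * real n + 1 \<le> C * (1 + \<theta> * real n * ln 2)"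
      using C(1) by (simp add: algebra_simps)
    also have "\<dots> \<le> C * exp (\<theta> * real n * ln 2)"
      using C(1) by (intro mult_left_mono exp_ge_add_one_self) auto
    finally show ?thesis by (simp add: powr_def)
  qed
  have "(2 * real n + 1) ^ k \<le> C ^ k * 2 powr (\<gamma> * real n)" for n
  proof -
    have "(2 * real n + 1) ^ k \<le> (C * 2 powr (\<theta> * real n)) ^ k"
      using base by (intro power_mono) auto
    also have "\<dots> = C ^ k * 2 powr (\<theta> * k * real n)"
      by (simp add: power_mult_distrib powr_power mult_ac)
    also have "\<dots> \<le> C ^ k * 2 powr (\<gamma> * real n)"
      using C(1) \<theta>(2) by (intro mult_left_mono powr_mono mult_right_mono) auto
    finally show ?thesis .
  qed
  then show ?thesis by blast
qed

text \<open>With \<open>u = x * ln 2\<close> the two summands are at most \<open>q / (q + u)\<close>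
  and \<open>u / (q + u)\<close>, which add up to 1. The first bound is
  \<open>1 + y <= exp y\<close>, the second a quadratic Taylor estimate.\<close>

lemma branching_threshold:
  fixes x :: real
  assumes "0 < x"
  shows "\<exists>q::nat. 0 < q \<and> 2 powr (- x / q) + 2 powr (- x * q) \<le> 1"
proof -
  define u where "u = x * ln 2"
  have u: "0 < u" using assms by (simp add: u_def)
  \<comment> \<open>The Taylor estimate needs
    \<open>q + u <= u * (1 + u * q + (u * q)^2 / 2)\<close>, which follows from
    \<open>u^3 * q >= 2\<close>.\<close>
  obtain q :: nat where q: "2 / u ^ 3 < q" using reals_Archimedean2 by blast
  have "0 < 2 / u ^ 3" using u by simp
  with q have q_pos: "0 < real q" by linarith
  have "exp (- (u / q)) \<le> q / (q + u)"
  proof -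
    have "1 + u / q \<le> exp (u / q)" by (rule exp_ge_add_one_self)
    then have "inverse (exp (u / q)) \<le> inverse (1 + u / q)"
      using u q_pos by (intro le_imp_inverse_le) (auto simp: add_pos_pos)
    also have "\<dots> = q / (q + u)" using q_pos u by (simp add: field_simps)
    finally show ?thesis by (simp add: exp_minus)
  qed
  moreover have "exp (- (u * q)) \<le> u / (q + u)"
  proof -
    have "q + u \<le> u * (1 + u * q + (u * q)\<^sup>2 / 2)"
    proof -
      have "2 \<le> u ^ 3 * q" using q u by (simp add: field_simps)
      then have "2 * real q \<le> u ^ 3 * q * q" using q_pos by (intro mult_right_mono) auto
      moreover have "0 \<le> u * u * q" using u by simp
      ultimately show ?thesis by (simp add: algebra_simps power2_eq_square power3_eq_cube)
    qed
    also have "\<dots> \<le> u * exp (u * q)"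
      using u by (intro mult_left_mono exp_lower_Taylor_quadratic) auto
    finally have "inverse (exp (u * q)) \<le> u / (q + u)"
      using u q_pos by (simp add: field_simps add_pos_pos)
    then show ?thesis by (simp add: exp_minus)
  qed
  moreover have "q / (q + u) + u / (q + u) = 1"
    using u q_pos by (simp add: add_divide_distrib[symmetric])
  ultimately have "exp (- (u / q)) + exp (- (u * q)) \<le> 1" by linarith
  then show ?thesis
    using q_pos by (intro exI[of _ q]) (simp add: powr_def u_def mult_ac)
qed

theorem theorem4:
  assumes "\<forall>\<epsilon>::real. \<epsilon> > 0 \<longrightarrow>
    solvable_in_time_O max3lin2_aa
      (\<lambda>(k, E). 2 powr (\<epsilon> * real k) * 2 powr (\<epsilon> * real (length E)))"
  shows "\<forall>\<delta>::real. \<delta> > 0 \<longrightarrow>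
    solvable_in_time_O three_sat (\<lambda>F. 2 powr (\<delta> * real (num_vars F)))"
proof (intro allI impI)
  fix \<delta> :: real assume \<delta>: "\<delta> > 0"
  \<comment> \<open>Half of the exponent pays for the number of nodes, the other half for the time
    per node.\<close>
  define \<gamma> where "\<gamma> = \<delta> / 2"
  have \<gamma>: "0 < \<gamma>" using \<delta> by (simp add: \<gamma>_def)
  obtain q :: nat where q: "0 < q" "2 powr (- (\<gamma> / 12) / q) + 2 powr (- (\<gamma> / 12) * q) \<le> 1"
    using branching_threshold[of "\<gamma> / 12"] \<gamma> by auto
  \<comment> \<open>The potential starts at no more than \<open>12 * q * n\<close>, so this choice
    makes the exponent in the weight of the input at most \<open>\<gamma> * n\<close>.\<close>
  define \<eta> where "\<eta> = \<gamma> / (12 * q)"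
  have \<eta>: "0 < \<eta>" "2 powr (- \<eta>) + 2 powr (- \<eta> * (real q * real q)) \<le> (1::real)"
  proof -
    have eq: "- \<eta> = - (\<gamma> / 12) / q" "- \<eta> * (real q * real q) = - (\<gamma> / 12) * q"
      using q(1) by (simp_all add: \<eta>_def)
    show "2 powr (- \<eta>) + 2 powr (- \<eta> * (real q * real q)) \<le> (1::real)"
      using q(2) unfolding eq(2) unfolding eq(1) .
    show "0 < \<eta>" using \<gamma> q(1) by (simp add: \<eta>_def)
  qed
  define K where "K = 1 + q + q * q"
  \<comment> \<open>A leaf has at most \<open>1 + 2 * n * K\<close> clauses, so parameter and number
    of equations add up to at most \<open>12 * (1 + 2 * n * K)\<close>. Times
    \<open>\<epsilon>\<close> this is \<open>12 * \<epsilon> + \<gamma> * n\<close>.\<close>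
  define \<epsilon> where "\<epsilon> = \<gamma> / (24 * K)"
  have K: "0 < K" by (simp add: K_def)
  have \<epsilon>: "0 < \<epsilon>" using \<gamma> K by (simp add: \<epsilon>_def)
  obtain P C where P: "decides_within P max3lin2_aa
      (\<lambda>I. C * (case I of (k, E) \<Rightarrow> 2 powr (\<epsilon> * real k) * 2 powr (\<epsilon> * real (length E))))"
    using assms \<epsilon> unfolding solvable_in_time_O_def by blast
  have "ptime UNIV enc_cnf (\<lambda>F. expand q (reduce F))"
    by (intro ptime_expand ptime_reduce ptime_id)
  then obtain c T where c: "\<And>F s. s 0 = enc_cnf F \<Longrightarrow> runs c s (T F) (\<lambda>s'. s' 0 = expand q (reduce F))"
    and T: "poly_bounded UNIV enc_cnf T"
    unfolding ptime_def by blast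
  obtain k where k: "\<And>F. T F \<le> Suc (leaves (enc_cnf F)) ^ k"
    using T by (auto simp: poly_bounded_def)
  obtain C' where C': "\<And>n. (2 * real n + 1) ^ (3 * k) \<le> C' * 2 powr (\<gamma> * real n)"
    using power_le_powr[OF \<gamma>, of "3 * k"] by blast
  define M where "M = max (var_bound c) (var_bound P)"
  \<comment> \<open>The absolute value is taken because the sign of \<open>C\<close> is unspecified;
    the power absorbs the summand \<open>12 * \<epsilon>\<close>.\<close>
  define C1 where "C1 = \<bar>C\<bar> * 2 powr (12 * \<epsilon>)"
  define C2 where "C2 = 9 ^ k * C'"
  \<comment> \<open>Variable \<open>M+1\<close> starts as \<open>Num 0\<close>, the empty stack, and
    the first instruction pushes the input onto it.\<close>
  let ?prog = "CSeq (CNode (M+1) 0 (M+1)) (CSeq (CWhile (M+1) (search_body M c P)) (CCopy 0 (M+2)))"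
  have "decides_within ?prog three_sat (\<lambda>F. (3 + 2 * (C2 + M + C1 + 14)) * 2 powr (\<delta> * real (num_vars F)))"
    unfolding decides_within_def
  proof
    fix F assume "F \<in> instances three_sat"
    then have wf: "wf_3cnf F" by (simp add: three_sat_def)
    define n where "n = num_vars F"
    define A where "A = 2 powr (\<gamma> * real n)"
    have A: "1 \<le> A" using \<gamma> by (simp add: A_def ge_one_powr_ge_zero)
    obtain L where F: "state_ok L (clause_sets F) q F" and L: "card L \<le> 2 * n"
      using state_ok_initial[OF wf] n_def by blast
    define S\<^sub>0 where "S\<^sub>0 = clause_sets F"
    \<comment> \<open>The 9 is 7 for the leaves per clause plus 2 for the two additive ones, which
      the cube of \<open>2 * n + 1\<close> dominates.\<close>
    define TE where "TE = (Suc (2 * n) ^ 3 * 9) ^ k"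
    define TP where "TP = nat \<lceil>C1 * A\<rceil>"
    have expand: "runs c s TE (\<lambda>s'. s' 0 = expand q (reduce G))"
      if G: "state_ok L S\<^sub>0 q G" "s 0 = enc_cnf G" for s G
    proof (rule runs_weaken[OF c[of s G, OF G(2)]])
      have "Suc (leaves (enc_cnf G)) \<le> Suc (card L) ^ 3 * 7 + 2"
        using state_ok_leaves[OF G(1)] by simp
      also have "\<dots> \<le> Suc (2 * n) ^ 3 * 7 + Suc (2 * n) ^ 3 * 2"
        using L by (intro add_mono mult_right_mono power_mono) auto
      finally have "Suc (leaves (enc_cnf G)) ^ k \<le> TE"
        unfolding TE_def by (intro power_mono) auto
      with k[of G] show "T G \<le> TE" by linarith
    qed
    have solve: "runs P (initial (encode max3lin2_aa (lin_instance G))) TP (\<lambda>s'. s' 0 \<noteq> Num 0 \<longleftrightarrow> satisfiable G)"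
      if G: "state_ok L S\<^sub>0 q G" "find_heart q G = None" for G
    proof -
      obtain m E where mE: "lin_instance G = (m, E)" by (cases "lin_instance G")
      have "\<forall>c\<in>set G. distinct c \<and> length c \<le> 3"
        using G(1) by (auto simp: state_ok_def admissible_def distinct_card)
      note lin = lin_instance_correct[OF this, unfolded mE fst_conv snd_conv]
      have "length G \<le> 1 + card L * K"
        using find_heart_None[OF G(1) q(1) G(2)] by (simp add: K_def)
      also have "\<dots> \<le> 1 + 2 * n * K" using L by (intro add_mono mult_right_mono) auto
      finally have "real (length G) \<le> real (1 + 2 * n * K)" by (rule of_nat_mono)
      then have "12 * real (length G) \<le> 12 * (1 + 2 * real n * real K)" by simp
      moreover have "real m + real (length E) \<le> 12 * real (length G)" using lin(3,4) by linarith
      ultimately have "real m + real (length E) \<le> 12 * (1 + 2 * real n * real K)" by (rule order.trans[rotated])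
      then have "\<epsilon> * (real m + real (length E)) \<le> \<epsilon> * (12 * (1 + 2 * real n * real K))"
        using \<epsilon> by (intro mult_left_mono) auto
      also have "\<dots> = 12 * \<epsilon> + \<gamma> * real n"
        using K by (simp add: \<epsilon>_def field_simps)
      finally have "2 powr (\<epsilon> * (real m + real (length E))) \<le> 2 powr (12 * \<epsilon> + \<gamma> * real n)"
        by (intro powr_mono) auto
      then have "\<bar>C\<bar> * (2 powr (\<epsilon> * real m) * 2 powr (\<epsilon> * real (length E))) \<le> C1 * A"
        unfolding powr_add distrib_left C1_def A_def mult.assoc by (intro mult_left_mono) auto
      moreover have "C * (2 powr (\<epsilon> * real m) * 2 powr (\<epsilon> * real (length E)))
          \<le> \<bar>C\<bar> * (2 powr (\<epsilon> * real m) * 2 powr (\<epsilon> * real (length E)))"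
        by (intro mult_right_mono) auto
      ultimately have C_le: "C * (2 powr (\<epsilon> * real m) * 2 powr (\<epsilon> * real (length E))) \<le> C1 * A"
        by linarith
      obtain t s' where *: "exec P (initial (encode max3lin2_aa (m, E))) t s'"
        "s' 0 \<noteq> Num 0 \<longleftrightarrow> is_yes max3lin2_aa (m, E)"
        "real t \<le> C * (2 powr (\<epsilon> * real m) * 2 powr (\<epsilon> * real (length E)))"
        using P lin(1) unfolding decides_within_def by fastforce
      have "t \<le> TP" using *(3) C_le unfolding TP_def by linarith
      with * lin(2) show ?thesis unfolding runs_def mE by blast
    qed
    let ?p = "state_weight L S\<^sub>0 q \<eta> F"
    let ?B = "TE + M + TP + 12"
    let ?I = "search_invariant M L S\<^sub>0 q \<eta> (satisfiable F)"
    let ?s = "(initial (enc_cnf F))(M+1 := Node (enc_cnf F) (Num 0))"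
    have "?I ?s ?p"
      unfolding search_invariant_def using F
      by (intro exI[of _ "[F]"]) (simp add: S\<^sub>0_def initial_def)
    then have "runs (CWhile (M+1) (search_body M c P)) ?s (nat \<lfloor>?p\<rfloor> * Suc ?B + 1)
        (\<lambda>r. r (M+1) = Num 0 \<and> (\<exists>p'. ?I r p'))"
      by (intro runs_While_potential search_invariant_nonneg[OF \<eta>(1)]
          runs_search_body[OF expand solve _ _ q(1) \<eta>]) (auto simp: M_def)
    then have "runs (CWhile (M+1) (search_body M c P)) ?s (nat \<lfloor>?p\<rfloor> * Suc ?B + 1)
        (\<lambda>r. r (M+2) \<noteq> Num 0 \<longleftrightarrow> satisfiable F)"
    proof (rule runs_weaken[OF _ order.refl])
      fix r assume "r (M+1) = Num 0 \<and> (\<exists>p'. ?I r p')"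
      then obtain Fs where "enc_list enc_cnf Fs = Num 0"
        "satisfiable F \<longleftrightarrow> r (M+2) \<noteq> Num 0 \<or> (\<exists>F\<in>set Fs. satisfiable F)"
        unfolding search_invariant_def by metis
      then show "r (M+2) \<noteq> Num 0 \<longleftrightarrow> satisfiable F" by (cases Fs) auto
    qed
    then have "runs ?prog (initial (enc_cnf F)) (Suc (nat \<lfloor>?p\<rfloor> * Suc ?B + 1 + Suc 0))
        (\<lambda>r. r 0 \<noteq> Num 0 \<longleftrightarrow> satisfiable F)"
      by (intro runs_Seq_basic runs_Seq) (simp add: runs_basic initial_def)
    then obtain t s' where run: "exec ?prog (initial (enc_cnf F)) t s'"
      "t \<le> Suc (nat \<lfloor>?p\<rfloor> * Suc ?B + 1 + Suc 0)" "s' 0 \<noteq> Num 0 \<longleftrightarrow> satisfiable F"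
      unfolding runs_def by blast
    have p: "real (nat \<lfloor>?p\<rfloor>) \<le> 2 * A"
    proof -
      have "potential L S\<^sub>0 q (clause_sets F) \<le> int (6 * q * card L)"
        unfolding potential_def by linarith
      also have "\<dots> \<le> int (6 * q * (2 * n))"
        using L by (intro of_nat_mono mult_left_mono) auto
      finally have "real_of_int (potential L S\<^sub>0 q (clause_sets F)) \<le> 12 * q * n"
        by linarith
      then have "\<eta> * real_of_int (potential L S\<^sub>0 q (clause_sets F)) \<le> \<eta> * (12 * q * n)"
        using \<eta>(1) by (intro mult_left_mono) auto
      also have "\<dots> = \<gamma> * real n" using q(1) by (simp add: \<eta>_def)
      finally have "2 powr (\<eta> * real_of_int (potential L S\<^sub>0 q (clause_sets F))) \<le> A"
        unfolding A_def by (intro powr_mono) auto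
      then have "?p \<le> 2 * A" by (simp add: state_weight_def)
      moreover have "0 \<le> ?p" using state_weight_ge_1[of L S\<^sub>0 q F \<eta>] F \<eta>(1) S\<^sub>0_def by simp
      ultimately show ?thesis by linarith
    qed
    \<comment> \<open>The 14 consists of the 12 of the loop body, one loop test and one for rounding
      up in \<open>TP\<close>.\<close>
    have B: "real (Suc ?B) \<le> (C2 + M + C1 + 14) * A"
    proof -
      have "real TE = ((2 * real n + 1) ^ 3 * 9) ^ k"
        by (simp add: TE_def add.commute)
      also have "\<dots> = 9 ^ k * (2 * real n + 1) ^ (3 * k)"
        unfolding power_mult_distrib power_mult by (rule mult.commute)
      also have "\<dots> \<le> C2 * A"
        unfolding C2_def A_def mult.assoc using C' by (intro mult_left_mono) auto
      finally have "real TE \<le> C2 * A" .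
      moreover have "0 \<le> C1 * A" using A by (simp add: C1_def)
      then have "real TP \<le> C1 * A + 1" unfolding TP_def by linarith
      moreover have "(real M + 14) * 1 \<le> (real M + 14) * A" using A by (intro mult_left_mono) auto
      ultimately show ?thesis by (simp add: algebra_simps)
    qed
    \<comment> \<open>The 3 steps outside the rounds are the initial push, the failing loop test and
      the final copy.\<close>
    have "real t \<le> real (nat \<lfloor>?p\<rfloor>) * real (Suc ?B) + 3"
    proof -
      have "real t \<le> real (nat \<lfloor>?p\<rfloor> * Suc ?B + 3)" using run(2) by (intro of_nat_mono) simp
      then show ?thesis by (simp only: of_nat_add of_nat_mult of_nat_numeral)
    qed
    also have "real (nat \<lfloor>?p\<rfloor>) * real (Suc ?B) \<le> (2 * A) * ((C2 + M + C1 + 14) * A)"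
      using p B A by (intro mult_mono) auto
    also have "3 \<le> 3 * (A * A)" using A mult_mono[of 1 A 1 A] by simp
    finally have "real t \<le> (3 + 2 * (C2 + M + C1 + 14)) * (A * A)"
      by (simp add: algebra_simps)
    also have "A * A = 2 powr (\<delta> * real n)"
      by (simp add: A_def \<gamma>_def flip: powr_add)
    finally have "real t \<le> (3 + 2 * (C2 + M + C1 + 14)) * 2 powr (\<delta> * real (num_vars F))"
      by (simp add: n_def)
    with run show "\<exists>t s. exec ?prog (initial (encode three_sat F)) t s \<and>
        (s 0 \<noteq> Num 0 \<longleftrightarrow> is_yes three_sat F) \<and>
        real t \<le> (3 + 2 * (C2 + M + C1 + 14)) * 2 powr (\<delta> * real (num_vars F))"
      unfolding three_sat_def by auto
  qed
  then show "solvable_in_time_O three_sat (\<lambda>F. 2 powr (\<delta> * real (num_vars F)))"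
    unfolding solvable_in_time_O_def by blast
qed

end
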